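(* Let $\mathcal{V}$ be a Banach $Cl$-space, let $U\subset\mathbb{C}$ be a conjugate symmetric open set, and let $T\in\mathcal{B}^{\rm r}(\mathcal{V})$ with $\sigma_{\mathbb C}(T)\subset U$. There exists an assignment $$\mathcal{O}_s(U,\mathfrak{K}_n)\ni F\mapsto F(T)\in\mathcal{B}^{\rm r}(\mathcal{V}),$$ which is an $\mathbb{R}$-linear map, such that (1) for all $F\in\mathcal{O}_s(U,\mathfrak{K}_n)$ and $f\in\mathcal{O}_s(U)$, we have $(Ff)(T)=F(T)f(T)$; (2) for every polynomial $P(\zeta)=\sum_{k=0}^m\mathbf a_k\zeta^k$, $\zeta\in\mathbb{C}$, with $\mathbf a_k\in\mathfrak{C}_n$ for all $k=0,1,\dots,m$, we have $P(T)=\sum_{k=0}^m\mathbf a_kT^k\in\mathcal{B}^{\rm r}(\mathcal{V})$.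
   Context: Fix an integer $n\ge0$. $\mathfrak{C}_n$ is the unital associative real algebra generated by $e_1,\dots,e_n$ with $e_j^2=-1$, $e_je_k=-e_ke_j$ ($j\ne k$), with basis $e_J=e_{j_1}\cdots e_{j_p}$ for $J=\{j_1<\dots<j_p\}\subset\{1,\dots,n\}$, $e_\emptyset=1$, and norm $|\sum_J a_Je_J|^2=\sum_J a_J^2$. $\mathfrak{K}_n=\mathbb{C}\otimes_{\mathbb R}\mathfrak{C}_n=\mathfrak{C}_n+i\mathfrak{C}_n$ (complex numbers are central), with conjugation $\overline{\mathbf a+i\mathbf b}=\mathbf a-i\mathbf b$ for $\mathbf a,\mathbf b\in\mathfrak{C}_n$. A Banach $Cl$-space is a real Banach space $\mathcal{V}$ which is a two-sided module (bimodule) over the real algebra $\mathfrak{C}_n$, such that for some constant $C>0$, $\|x\mathbf a\|\le C\|x\||\mathbf a|$ and $\|\mathbf a x\|\le C\|x\||\mathbf a|$ for all $x\in\mathcal{V}$, $\mathbf a\in\mathfrak{C}_n$. $\mathcal{B}^{\rm r}(\mathcal{V})$ is the algebra of bounded $\mathbb{R}$-linear operators $T$ on $\mathcal{V}$ with $T(x\mathbf a)=T(x)\mathbf a$ for all $x\in\mathcal{V}$, $\mathbf a\in\mathfrak{C}_n$. For $\mathbf a\in\mathfrak{C}_n$ and $T\in\mathcal{B}^{\rm r}(\mathcal{V})$, $\mathbf aT$ is the operator $x\mapsto\mathbf a\,T(x)$. $\mathcal{V}_{\mathbb C}=\mathcal{V}+i\mathcal{V}$ is the complexification, $T_{\mathbb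 C}(x+iy)=Tx+iTy$, and the complex spectrum of $T$ is $\sigma_{\mathbb C}(T)=\sigma(T_{\mathbb C})$. A set $U\subset\mathbb{C}$ is conjugate symmetric if $\zeta\in U\iff\bar\zeta\in U$. $\mathcal{O}_s(U,\mathfrak{K}_n)$ is the set of analytic functions $F:U\to\mathfrak{K}_n$ with $F(\bar\zeta)=\overline{F(\zeta)}$ for all $\zeta\in U$; $\mathcal{O}_s(U)\subset\mathcal{O}_s(U,\mathfrak{K}_n)$ consists of the $\mathbb{C}$-valued ones. *)

theory Defs
  imports "HOL-Analysis.Analysis"
begin

text \<open>
  The Clifford algebra on the generators \<open>e\<^sub>1, \<dots>, e\<^sub>n\<close> with \<open>e\<^sub>j\<^sup>2 = -1\<close>, in coordinates: \<open>a\<close> stands for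
  \<open>\<Sum>J. a J e\<^sub>J\<close>, where \<open>J\<close> runs over the subsets of \<open>{1..n}\<close>, and \<open>a\<close> vanishes on all other index
  sets. Real coefficients give the real algebra, complex coefficients its complexification.
\<close>

definition clifford :: "nat \<Rightarrow> (nat set \<Rightarrow> 'k::zero) set" where
  "clifford n = {a. \<forall>J. \<not> J \<subseteq> {1..n} \<longrightarrow> a J = 0}"

text \<open>
  \<open>e\<^sub>J e\<^sub>K = cl_sign J K e\<^sub>L\<close> with \<open>L\<close> the symmetric difference of \<open>J\<close> and \<open>K\<close>: sorting costs a factor
  \<open>-1\<close> for each pair \<open>k < j\<close>, and cancelling \<open>e\<^sub>j e\<^sub>j = -1\<close> one for each pair \<open>k = j\<close>.
\<close>

definition cl_sign :: "nat set \<Rightarrow> nat set \<Rightarrow> 'k::comm_ring_1" where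
  "cl_sign J K = (\<Prod>j\<in>J. \<Prod>k\<in>K. if k \<le> j then - 1 else 1)"

definition cl_mult ::
  "nat \<Rightarrow> (nat set \<Rightarrow> 'k::comm_ring_1) \<Rightarrow> (nat set \<Rightarrow> 'k) \<Rightarrow> nat set \<Rightarrow> 'k" where
  "cl_mult n a b = (\<lambda>L. \<Sum>J\<in>Pow {1..n}. \<Sum>K\<in>Pow {1..n}.
     if sym_diff J K = L then cl_sign J K * a J * b K else 0)"

definition cl_basis :: "nat set \<Rightarrow> nat set \<Rightarrow> 'k::comm_ring_1" where
  "cl_basis J = (\<lambda>K. if K = J then 1 else 0)"

definition cl_scalar :: "'k::comm_ring_1 \<Rightarrow> nat set \<Rightarrow> 'k" where
  "cl_scalar c = (\<lambda>J. if J = {} then c else 0)"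

definition cl_norm :: "nat \<Rightarrow> (nat set \<Rightarrow> real) \<Rightarrow> real" where
  "cl_norm n a = sqrt (\<Sum>J\<in>Pow {1..n}. (a J)\<^sup>2)"

text \<open>\<open>a + i b\<close> is sent to \<open>a - i b\<close> for real \<open>a, b\<close>; no Clifford reversal or grading is involved.\<close>

definition cl_cnj :: "(nat set \<Rightarrow> complex) \<Rightarrow> nat set \<Rightarrow> complex" where
  "cl_cnj a = (\<lambda>J. cnj (a J))"

text \<open>The multiplication satisfies the defining relations of the Clifford algebra.\<close>

lemma cl_mult_closed: "cl_mult n a b \<in> clifford n"
proof -
  have "cl_mult n a b L = 0" if "\<not> L \<subseteq> {1..n}" for L
    unfolding cl_mult_def
  proof (intro sum.neutral ballI)
    fix J K assume "J \<in> Pow {1..n}" "K \<in> Pow {1..n}"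
    then have "sym_diff J K \<noteq> L" using that by blast
    then show "(if sym_diff J K = L then cl_sign J K * a J * b K else 0) = 0" by simp
  qed
  then show ?thesis unfolding clifford_def by simp
qed

lemma cl_mult_eq:
  assumes "L \<subseteq> {1..n}"
  shows "cl_mult n a b L
    = (\<Sum>J\<in>Pow {1..n}. cl_sign J (sym_diff J L) * a J * b (sym_diff J L))"
proof -
  have "(\<Sum>K\<in>Pow {1..n}. if sym_diff J K = L then cl_sign J K * a J * b K else 0)
      = cl_sign J (sym_diff J L) * a J * b (sym_diff J L)" if "J \<in> Pow {1..n}" for J
  proof -
    have eq: "sym_diff J K = L \<longleftrightarrow> K = sym_diff J L" for K by blast
    have "sym_diff J L \<in> Pow {1..n}" using that assms by auto
    then show ?thesis unfolding eq by simp
  qed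
  then show ?thesis unfolding cl_mult_def by simp
qed

lemma prod_sym_diff:
  fixes f :: "'a \<Rightarrow> 'k::comm_ring_1"
  assumes "finite J" "finite K" "\<And>j. f j * f j = 1"
  shows "prod f (sym_diff J K) = prod f J * prod f K"
proof -
  have "prod f J = prod f (J - K) * prod f (J \<inter> K)"
    using assms(1) by (metis prod.Int_Diff mult.commute)
  moreover have "prod f K = prod f (K - J) * prod f (J \<inter> K)"
    using assms(2) by (metis prod.Int_Diff mult.commute Int_commute)
  moreover have "prod f (J \<inter> K) * prod f (J \<inter> K) = 1"
    by (simp add: prod.distrib[symmetric] assms(3))
  moreover have "prod f (sym_diff J K) = prod f (J - K) * prod f (K - J)"
    using assms(1,2) by (intro prod.union_disjoint) auto
  moreover have "(p * i) * (q * i) = (p * q) * (i * i)" for p q i :: 'k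
    by (simp add: ac_simps)
  ultimately show ?thesis by (simp only: mult_1_right)
qed

lemma cl_sign_square: "(cl_sign J K :: 'k::comm_ring_1) * cl_sign J K = 1"
  unfolding cl_sign_def prod.distrib[symmetric] by (intro prod.neutral ballI) auto

lemma cl_sign_sym_diff_left:
  assumes "finite J" "finite K"
  shows "cl_sign (sym_diff J K) L = (cl_sign J L * cl_sign K L :: 'k::comm_ring_1)"
  unfolding cl_sign_def
  by (rule prod_sym_diff[OF assms, where f = "\<lambda>j. \<Prod>k\<in>L. if k \<le> j then - 1 else (1 :: 'k)"])
     (auto simp: prod.distrib[symmetric] intro!: prod.neutral)

lemma cl_sign_sym_diff_right:
  assumes "finite K" "finite L"
  shows "cl_sign J (sym_diff K L) = (cl_sign J K * cl_sign J L :: 'k::comm_ring_1)"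
  unfolding cl_sign_def prod.distrib[symmetric]
  by (intro prod.cong refl prod_sym_diff assms) auto

lemma cl_mult_assoc: "cl_mult n (cl_mult n a b) c = cl_mult n a (cl_mult n b c)"
proof
  fix L
  let ?N = "Pow {1..n}"
  have fin: "finite X" if "X \<subseteq> {1..n}" for X :: "nat set"
    using that finite_subset by blast
  show "cl_mult n (cl_mult n a b) c L = cl_mult n a (cl_mult n b c) L"
  proof (cases "L \<subseteq> {1..n}")
    case False
    then show ?thesis
      using cl_mult_closed[of n "cl_mult n a b" c] cl_mult_closed[of n a "cl_mult n b c"]
      unfolding clifford_def by simp
  next
    case True
    define t where "t J P = cl_sign P (sym_diff P L) * (cl_sign J (sym_diff J P) * a J
      * b (sym_diff J P)) * c (sym_diff P L)" for J P
    have "cl_mult n (cl_mult n a b) c L = (\<Sum>P\<in>?N. \<Sum>J\<in>?N. t J P)"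
      unfolding cl_mult_eq[OF True] t_def
      by (intro sum.cong refl) (simp add: cl_mult_eq sum_distrib_left sum_distrib_right)
    also have "\<dots> = (\<Sum>J\<in>?N. \<Sum>P\<in>?N. t J P)" by (rule sum.swap)
    also have "\<dots> = (\<Sum>J\<in>?N. \<Sum>Q\<in>?N. t J (sym_diff J Q))"
    proof (rule sum.cong[OF refl])
      fix J assume J: "J \<in> ?N"
      have idem: "sym_diff J (sym_diff J P) = P" for P by blast
      show "(\<Sum>P\<in>?N. t J P) = (\<Sum>Q\<in>?N. t J (sym_diff J Q))"
        using J by (intro sum.reindex_bij_witness[where i = "sym_diff J" and j = "sym_diff J"])
          (blast | simp only: idem)+
    qed
    also have "\<dots> = cl_mult n a (cl_mult n b c) L"
      unfolding cl_mult_eq[OF True]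
    proof (rule sum.cong[OF refl])
      fix J assume J: "J \<in> ?N"
      have JL: "sym_diff J L \<subseteq> {1..n}" using J True by auto
      have "t J (sym_diff J Q) = cl_sign J (sym_diff J L) * a J *
          (cl_sign Q (sym_diff Q (sym_diff J L)) * b Q * c (sym_diff Q (sym_diff J L)))"
        if Q: "Q \<in> ?N" for Q
      proof -
        define M where "M = sym_diff Q (sym_diff J L)"
        have M: "sym_diff (sym_diff J Q) L = M" unfolding M_def by blast
        have M': "sym_diff J L = sym_diff Q M" unfolding M_def by blast
        have JJQ: "sym_diff J (sym_diff J Q) = Q" by blast
        have fins: "finite J" "finite Q" "finite M"
          using J Q JL fin unfolding M_def by auto
        show ?thesis
          unfolding t_def M JJQ M_def[symmetric] unfolding M'
          using fins by (simp add: cl_sign_sym_diff_left cl_sign_sym_diff_right algebra_simps)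
      qed
      then show "(\<Sum>Q\<in>?N. t J (sym_diff J Q))
          = cl_sign J (sym_diff J L) * a J * cl_mult n b c (sym_diff J L)"
        unfolding cl_mult_eq[OF JL] sum_distrib_left by (intro sum.cong refl) blast
    qed
    finally show ?thesis .
  qed
qed

lemma cl_mult_basis:
  assumes "J \<subseteq> {1..n}" "K \<subseteq> {1..n}"
  shows "cl_mult n (cl_basis J) (cl_basis K)
    = (\<lambda>L. cl_sign J K * cl_basis (sym_diff J K) L :: 'k::comm_ring_1)"
proof
  fix L
  have "cl_mult n (cl_basis J) (cl_basis K) L
      = (\<Sum>J'\<in>Pow {1..n}. \<Sum>K'\<in>Pow {1..n}. if K' = K then if J' = J then
          if sym_diff J K = L then (cl_sign J K :: 'k) else 0 else 0 else 0)"
    unfolding cl_mult_def cl_basis_def by (intro sum.cong refl) simp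
  also have "\<dots> = cl_sign J K * cl_basis (sym_diff J K) L"
    using assms by (auto simp: cl_basis_def)
  finally show "cl_mult n (cl_basis J) (cl_basis K) L
      = (cl_sign J K * cl_basis (sym_diff J K) L :: 'k)" .
qed

lemma cl_scalar_mult_left:
  assumes "a \<in> clifford n"
  shows "cl_mult n (cl_scalar c) a = (\<lambda>J. c * a J)"
proof
  fix L
  show "cl_mult n (cl_scalar c) a L = c * a L"
  proof (cases "L \<subseteq> {1..n}")
    case True
    have "cl_mult n (cl_scalar c) a L = (\<Sum>J\<in>Pow {1..n}. if J = {} then c * a L else 0)"
      unfolding cl_mult_eq[OF True] by (intro sum.cong refl) (auto simp: cl_scalar_def cl_sign_def)
    then show ?thesis by simp
  next
    case False
    then show ?thesis
      using assms cl_mult_closed[of n "cl_scalar c" a] unfolding clifford_def by simp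
  qed
qed

lemma cl_scalar_mult_right:
  assumes "a \<in> clifford n"
  shows "cl_mult n a (cl_scalar c) = (\<lambda>J. c * a J)"
proof
  fix L
  show "cl_mult n a (cl_scalar c) L = c * a L"
  proof (cases "L \<subseteq> {1..n}")
    case True
    have "cl_mult n a (cl_scalar c) L = (\<Sum>J\<in>Pow {1..n}. if J = L then c * a L else 0)"
      unfolding cl_mult_eq[OF True]
      by (intro sum.cong refl) (auto simp: cl_scalar_def cl_sign_def)
    then show ?thesis using True by simp
  next
    case False
    then show ?thesis
      using assms cl_mult_closed[of n a "cl_scalar c"] unfolding clifford_def by simp
  qed
qed

lemma cl_generator_square:
  assumes "j \<in> {1..n}"
  shows "cl_mult n (cl_basis {j}) (cl_basis {j}) = (cl_scalar (- 1) :: nat set \<Rightarrow> 'k::comm_ring_1)"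
  using assms by (subst cl_mult_basis) (auto simp: cl_sign_def cl_basis_def cl_scalar_def)

lemma cl_generator_anticommute:
  assumes "j \<in> {1..n}" "k \<in> {1..n}" "j \<noteq> k"
  shows "cl_mult n (cl_basis {j}) (cl_basis {k})
    = (\<lambda>L. - cl_mult n (cl_basis {k}) (cl_basis {j}) L :: 'k::comm_ring_1)"
  using assms
  by (simp add: cl_mult_basis cl_sign_def insert_Diff_if Un_commute)

lemma cl_basis_insert:
  assumes "insert j J \<subseteq> {1..n}" "\<And>i. i \<in> J \<Longrightarrow> i < j"
  shows "cl_mult n (cl_basis J) (cl_basis {j}) = (cl_basis (insert j J) :: nat set \<Rightarrow> 'k::comm_ring_1)"
proof -
  have "sym_diff J {j} = insert j J" using assms(2) by auto
  moreover have "cl_sign J {j} = (1 :: 'k)"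
    unfolding cl_sign_def using assms(2) by (intro prod.neutral) (auto dest: leD)
  ultimately show ?thesis using assms(1) by (simp add: cl_mult_basis)
qed

text \<open>
  \<open>lact a x\<close> and \<open>ract x a\<close> are \<open>a x\<close> and \<open>x a\<close>; they are only constrained for \<open>a\<close> in the algebra.
\<close>

locale banach_cl_space =
  fixes n :: nat
    and lact :: "(nat set \<Rightarrow> real) \<Rightarrow> 'v::banach \<Rightarrow> 'v"
    and ract :: "'v \<Rightarrow> (nat set \<Rightarrow> real) \<Rightarrow> 'v"
  assumes lact_add_right: "a \<in> clifford n \<Longrightarrow> lact a (x + y) = lact a x + lact a y"
    and lact_add_left: "a \<in> clifford n \<Longrightarrow> b \<in> clifford n \<Longrightarrow>
      lact (\<lambda>J. a J + b J) x = lact a x + lact b x"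
    and lact_mult: "a \<in> clifford n \<Longrightarrow> b \<in> clifford n \<Longrightarrow>
      lact (cl_mult n a b) x = lact a (lact b x)"
    and lact_scalar: "lact (cl_scalar r) x = r *\<^sub>R x"
    and ract_add_left: "a \<in> clifford n \<Longrightarrow> ract (x + y) a = ract x a + ract y a"
    and ract_add_right: "a \<in> clifford n \<Longrightarrow> b \<in> clifford n \<Longrightarrow>
      ract x (\<lambda>J. a J + b J) = ract x a + ract x b"
    and ract_mult: "a \<in> clifford n \<Longrightarrow> b \<in> clifford n \<Longrightarrow>
      ract x (cl_mult n a b) = ract (ract x a) b"
    and ract_scalar: "ract x (cl_scalar r) = r *\<^sub>R x"
    and lact_ract: "a \<in> clifford n \<Longrightarrow> b \<in> clifford n \<Longrightarrow>
      ract (lact a x) b = lact a (ract x b)"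
    and act_bounded: "\<exists>C>0. \<forall>x. \<forall>a\<in>clifford n.
      norm (ract x a) \<le> C * norm x * cl_norm n a \<and> norm (lact a x) \<le> C * norm x * cl_norm n a"

definition right_linear_ops ::
  "nat \<Rightarrow> ('v::banach \<Rightarrow> (nat set \<Rightarrow> real) \<Rightarrow> 'v) \<Rightarrow> ('v \<Rightarrow>\<^sub>L 'v) set" where
  "right_linear_ops n ract =
     {T. \<forall>x. \<forall>a\<in>clifford n. blinfun_apply T (ract x a) = ract (blinfun_apply T x) a}"

text \<open>The complexification of \<open>'v\<close> is \<open>'v \<times> 'v\<close>, with \<open>(x, y)\<close> standing for \<open>x + i y\<close>.\<close>

definition cscale :: "complex \<Rightarrow> 'v::real_normed_vector \<times> 'v \<Rightarrow> 'v \<times> 'v" where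
  "cscale z p = (Re z *\<^sub>R fst p - Im z *\<^sub>R snd p, Im z *\<^sub>R fst p + Re z *\<^sub>R snd p)"

definition bounded_clinear_ops :: "('v::real_normed_vector \<times> 'v \<Rightarrow> 'v \<times> 'v) set" where
  "bounded_clinear_ops = {S. bounded_linear S \<and> (\<forall>z p. S (cscale z p) = cscale z (S p))}"

definition complexify :: "('v::banach \<Rightarrow>\<^sub>L 'v) \<Rightarrow> 'v \<times> 'v \<Rightarrow> 'v \<times> 'v" where
  "complexify T p = (blinfun_apply T (fst p), blinfun_apply T (snd p))"

definition complex_spectrum :: "('v::banach \<Rightarrow>\<^sub>L 'v) \<Rightarrow> complex set" where
  "complex_spectrum T = {z. \<not> (\<exists>S\<in>bounded_clinear_ops.
     S \<circ> (\<lambda>p. cscale z p - complexify T p) = id \<and> (\<lambda>p. cscale z p - complexify T p) \<circ> S = id)}"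

definition conjugate_symmetric :: "complex set \<Rightarrow> bool" where
  "conjugate_symmetric U \<longleftrightarrow> (\<forall>z. z \<in> U \<longleftrightarrow> cnj z \<in> U)"

text \<open>
  Only the values on \<open>U\<close> matter. The functions take values in a finite-dimensional complex space,
  so analyticity is that of the coordinates.
\<close>

definition stem_functions :: "nat \<Rightarrow> complex set \<Rightarrow> (complex \<Rightarrow> nat set \<Rightarrow> complex) set" where
  "stem_functions n U = {F. (\<forall>z\<in>U. F z \<in> clifford n)
     \<and> (\<forall>J\<subseteq>{1..n}. (\<lambda>z. F z J) analytic_on U)
     \<and> (\<forall>z\<in>U. F (cnj z) = cl_cnj (F z))}"

definition scalar_stem_functions :: "nat \<Rightarrow> complex set \<Rightarrow> (complex \<Rightarrow> nat set \<Rightarrow> complex) set" where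
  "scalar_stem_functions n U = {f \<in> stem_functions n U. \<forall>z\<in>U. f z \<in> range cl_scalar}"

text \<open>The polynomial \<open>\<Sum>k\<le>m. a k z\<^sup>k\<close> with coefficients in the real algebra.\<close>

definition cl_poly :: "(nat \<Rightarrow> nat set \<Rightarrow> real) \<Rightarrow> nat \<Rightarrow> complex \<Rightarrow> nat set \<Rightarrow> complex" where
  "cl_poly a m z = (\<lambda>J. \<Sum>k\<le>m. of_real (a k J) * z ^ k)"

end

theory Submission
  imports Defs "HOL-Complex_Analysis.Cauchy_Integral_Formula"
begin

text \<open>
  Writing \<open>F = \<Sum>J. F\<^sub>J e\<^sub>J\<close>, the components \<open>F\<^sub>J\<close> are complex valued analytic functions with
  \<open>F\<^sub>J (cnj z) = cnj (F\<^sub>J z)\<close>, and \<open>F(T)\<close> is \<open>\<Sum>J. e\<^sub>J F\<^sub>J(T)\<close>. So all claims reduce to the scalar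
  functional calculus of the complexified operator. There \<open>f(T)\<close> is characterised as the operator
  \<open>A\<close> with \<open>f(z) - A = (z - T) h(z)\<close> on \<open>U\<close> for some operator valued \<open>h\<close> satisfying
  Cauchy's theorem on rectangles. Such an \<open>A\<close> is unique, because multiplying by the resolvent and
  integrating around the spectrum recovers it; hence the calculus is linear and multiplicative,
  commutes with whatever commutes with \<open>T\<close>, and yields real operators for functions that commute
  with conjugation. Existence is the Riesz-Dunford integral.
\<close>

text \<open>The complexification is handled as a real Banach space with an operator \<open>J\<close>
  as imaginary unit, so complex linearity becomes commutation with \<open>J\<close>. Were f(T)
  defined by a contour integral, multiplicativity would involve two nested contours. With the
  division identity it is plain algebra: if A, B are the values of f, g, then fg - AB = f(g - B) +
  (f - A)B, and both summands are divisible by z - T. Integrals enter only twice, in uniqueness and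
  in existence. Even there no curve around the spectrum is constructed. Small squares of a grid
  cover the spectrum, and their inner edges cancel in pairs. These edges may run through the
  spectrum, where the resolvent does not exist; this forces the cutoff near the spectrum and the
  bookkeeping of the error it causes. On the Clifford side the obstacle is that T commutes with
  right multiplications but in general not with left multiplication by e_J. Right linearity of F(T)
  therefore comes from commutation with right multiplications, and every e_J stays leftmost. In
  (Ff)(T) this works because f is scalar and adds no basis element between F_J(T) and f(T).\<close>

lemma blinfun_compose_assoc: "(A o\<^sub>L B) o\<^sub>L C = A o\<^sub>L (B o\<^sub>L C)"
  by (rule blinfun_eqI) simp

lemma id_blinfun_compose [simp]: "id_blinfun o\<^sub>L A = A" "A o\<^sub>L id_blinfun = A"
  by (rule blinfun_eqI, simp)+

lemmas compose_simps = blinfun_compose_assoc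
  bounded_bilinear.add_left[OF bounded_bilinear_blinfun_compose]
  bounded_bilinear.add_right[OF bounded_bilinear_blinfun_compose]
  bounded_bilinear.diff_left[OF bounded_bilinear_blinfun_compose]
  bounded_bilinear.diff_right[OF bounded_bilinear_blinfun_compose]
  bounded_bilinear.minus_left[OF bounded_bilinear_blinfun_compose]
  bounded_bilinear.minus_right[OF bounded_bilinear_blinfun_compose]
  bounded_bilinear.scaleR_left[OF bounded_bilinear_blinfun_compose]
  bounded_bilinear.scaleR_right[OF bounded_bilinear_blinfun_compose]

lemmas compose_sum_left = bounded_bilinear.sum_left[OF bounded_bilinear_blinfun_compose]
lemmas compose_sum_right = bounded_bilinear.sum_right[OF bounded_bilinear_blinfun_compose]

lemma bounded_linear_compose_left: "bounded_linear (\<lambda>A. A o\<^sub>L B)"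
  by (rule bounded_bilinear.bounded_linear_left[OF bounded_bilinear_blinfun_compose])

lemma bounded_linear_compose_right: "bounded_linear (\<lambda>B. A o\<^sub>L B)"
  by (rule bounded_bilinear.bounded_linear_right[OF bounded_bilinear_blinfun_compose])

subsection \<open>Operator valued integrals over rectangles\<close>

definition rect_edges :: "complex \<Rightarrow> complex \<Rightarrow> complex set" where
  "rect_edges a b = {z. Re z \<in> {Re a, Re b} \<and> Im z \<in> {Im a..Im b}} \<union>
    {z. Im z \<in> {Im a, Im b} \<and> Re z \<in> {Re a..Re b}}"

definition rect :: "complex \<Rightarrow> complex \<Rightarrow> bool" where
  "rect a b \<longleftrightarrow> Re a \<le> Re b \<and> Im a \<le> Im b"

lemma rect_edges_subset: "rect a b \<Longrightarrow> rect_edges a b \<subseteq> cbox a b"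
  by (auto simp: rect_edges_def rect_def in_cbox_complex_iff)

lemma compact_rect_edges: "rect a b \<Longrightarrow> compact (rect_edges a b)"
  using path_image_rectpath[of a b] compact_path_image[OF path_rectpath, of a b]
  by (simp add: rect_edges_def rect_def)

lemma continuous_on_Complex [continuous_intros]:
  fixes f g :: "'a::topological_space \<Rightarrow> real"
  assumes "continuous_on S f" "continuous_on S g"
  shows "continuous_on S (\<lambda>x. Complex (f x) (g x))"
  unfolding Complex_eq by (intro continuous_intros assms)

section \<open>Complex structures on a real Banach space and Cauchy's theorem for rectangles\<close>

locale complex_structure =
  fixes J :: "'w::banach \<Rightarrow>\<^sub>L 'w"
  assumes J_square: "J o\<^sub>L J = - id_blinfun"
begin

text \<open>Complex scalars are represented as operators, so that scalar multiplication is
  composition and needs no vector space structure beyond the real one.\<close>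

definition cs :: "complex \<Rightarrow> 'w \<Rightarrow>\<^sub>L 'w" where
  "cs z = Re z *\<^sub>R id_blinfun + Im z *\<^sub>R J"

lemma cs_0 [simp]: "cs 0 = 0" and cs_1 [simp]: "cs 1 = id_blinfun"
  and cs_add: "cs (z + w) = cs z + cs w" and cs_diff: "cs (z - w) = cs z - cs w"
  and cs_minus: "cs (- z) = - cs z"
  and cs_of_real: "cs (of_real r) = r *\<^sub>R id_blinfun"
  and cs_i: "cs \<i> = J"
  by (auto simp: cs_def algebra_simps)

lemma cs_mult: "cs (z * w) = cs z o\<^sub>L cs w"
  by (simp add: cs_def compose_simps J_square algebra_simps)

lemma cs_cancel: "z * w = 1 \<Longrightarrow> cs z o\<^sub>L (cs w o\<^sub>L A) = A"
  using cs_mult[of z w] by (simp add: blinfun_compose_assoc[symmetric])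

lemma cs_commute: "J o\<^sub>L A = A o\<^sub>L J \<Longrightarrow> cs z o\<^sub>L A = A o\<^sub>L cs z"
  by (simp add: cs_def compose_simps)

lemma cs_cs_commute: "cs z o\<^sub>L cs w = cs w o\<^sub>L cs z"
  by (metis cs_mult mult.commute)

lemma cs_left_commute: "cs z o\<^sub>L (cs w o\<^sub>L A) = cs w o\<^sub>L (cs z o\<^sub>L A)"
  by (metis blinfun_compose_assoc cs_cs_commute)

lemma J_cs_commute: "J o\<^sub>L cs z = cs z o\<^sub>L J"
  by (metis cs_cs_commute cs_i)

text \<open>The norm need not be homogeneous for complex scalars, since \<open>J\<close> is only
  assumed bounded; this constant repairs the estimates.\<close>

definition cs_bound :: real where "cs_bound = 1 + norm J"

lemma cs_bound_ge_1: "cs_bound \<ge> 1"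
  by (simp add: cs_bound_def)

lemma norm_cs_le: "norm (cs z) \<le> cs_bound * cmod z"
proof -
  have "norm (cs z) \<le> \<bar>Re z\<bar> * norm (id_blinfun :: 'w \<Rightarrow>\<^sub>L 'w) + \<bar>Im z\<bar> * norm J"
    unfolding cs_def by (rule norm_triangle_le) simp
  also have "\<dots> \<le> cmod z * 1 + cmod z * norm J"
    by (intro add_mono mult_mono norm_blinfun_id_le abs_Re_le_cmod abs_Im_le_cmod) auto
  finally show ?thesis by (simp add: cs_bound_def algebra_simps)
qed

lemma norm_cs_compose_le: "norm (cs z o\<^sub>L A) \<le> cs_bound * cmod z * norm A"
  by (rule order_trans[OF norm_blinfun_compose mult_right_mono[OF norm_cs_le norm_ge_zero]])

lemma bounded_linear_cs: "bounded_linear cs"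
proof
  show "\<exists>K. \<forall>x. norm (cs x) \<le> norm x * K"
    using norm_cs_le by (metis mult.commute)
qed (auto simp: cs_def algebra_simps)

lemmas continuous_on_cs [continuous_intros] = bounded_linear.continuous_on[OF bounded_linear_cs]

text \<open>The counterclockwise integral over the boundary of the rectangle with corners \<open>a\<close> and \<open>b\<close>.
  \<open>integral\<close> is total, so statements about \<open>rint\<close> need continuity on the edges only where they
  use linearity or bounds.\<close>

definition rint :: "complex \<Rightarrow> complex \<Rightarrow> (complex \<Rightarrow> 'w \<Rightarrow>\<^sub>L 'w) \<Rightarrow> 'w \<Rightarrow>\<^sub>L 'w" where
  "rint a b g =
     (integral {Re a..Re b} (\<lambda>x. g (Complex x (Im a)))
        - integral {Re a..Re b} (\<lambda>x. g (Complex x (Im b))))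
     + (J o\<^sub>L (integral {Im a..Im b} (\<lambda>y. g (Complex (Re b) y))
        - integral {Im a..Im b} (\<lambda>y. g (Complex (Re a) y))))"

lemma edge_integrable:
  fixes g :: "complex \<Rightarrow> 'a::banach"
  assumes "continuous_on (rect_edges a b) g" "rect a b"
  shows "(\<lambda>x. g (Complex x (Im a))) integrable_on {Re a..Re b}"
    "(\<lambda>x. g (Complex x (Im b))) integrable_on {Re a..Re b}"
    "(\<lambda>y. g (Complex (Re b) y)) integrable_on {Im a..Im b}"
    "(\<lambda>y. g (Complex (Re a) y)) integrable_on {Im a..Im b}"
  using assms
  by (auto intro!: integrable_continuous_real continuous_on_compose2[OF assms(1)] continuous_intros
      simp: rect_edges_def rect_def)

lemma rint_cong: "(\<And>z. z \<in> rect_edges a b \<Longrightarrow> f z = g z) \<Longrightarrow> rect a b \<Longrightarrow> rint a b f = rint a b g"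
  unfolding rint_def
  by (intro arg_cong2[where f = "(+)"] arg_cong2[where f = "(-)"] arg_cong2[where f = "(o\<^sub>L)"] refl integral_cong)
     (auto simp: rect_edges_def rect_def)

lemma rint_zero [simp]: "rint a b (\<lambda>z. 0) = 0"
  by (simp add: rint_def)

lemma rint_add:
  assumes "continuous_on (rect_edges a b) f" "continuous_on (rect_edges a b) g" "rect a b"
  shows "rint a b (\<lambda>z. f z + g z) = rint a b f + rint a b g"
  using edge_integrable[OF assms(1,3)] edge_integrable[OF assms(2,3)]
  by (simp add: rint_def integral_add compose_simps)

text \<open>The vertical edges carry \<open>J\<close> to the left of the integrand, and
  \<open>B\<close> has to be moved past it; this is what the commutation hypothesis is for.\<close>

lemma rint_compose_left:
  assumes "continuous_on (rect_edges a b) f" "rect a b" "J o\<^sub>L B = B o\<^sub>L J"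
  shows "rint a b (\<lambda>z. B o\<^sub>L f z) = B o\<^sub>L rint a b f"
proof -
  have B: "integral X (\<lambda>x. B o\<^sub>L k x) = B o\<^sub>L integral X k" if "k integrable_on X" for k and X :: "real set"
    using integral_linear[OF that bounded_linear_compose_right] by (simp add: o_def)
  have JB: "J o\<^sub>L (B o\<^sub>L X) = B o\<^sub>L (J o\<^sub>L X)" for X :: "'w \<Rightarrow>\<^sub>L 'w"
    by (metis assms(3) blinfun_compose_assoc)
  show ?thesis
    using edge_integrable[OF assms(1,2)] by (simp add: rint_def B JB compose_simps)
qed

lemma rint_compose_right:
  assumes "continuous_on (rect_edges a b) f" "rect a b"
  shows "rint a b (\<lambda>z. f z o\<^sub>L B) = rint a b f o\<^sub>L B"
proof -
  have B: "integral X (\<lambda>x. k x o\<^sub>L B) = integral X k o\<^sub>L B" if "k integrable_on X" for k and X :: "real set"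
    using integral_linear[OF that bounded_linear_compose_left] by (simp add: o_def)
  show ?thesis
    using edge_integrable[OF assms(1,2)] by (simp add: rint_def B compose_simps)
qed

lemma rint_diff:
  assumes "continuous_on (rect_edges a b) f" "continuous_on (rect_edges a b) g" "rect a b"
  shows "rint a b (\<lambda>z. f z - g z) = rint a b f - rint a b g"
  using edge_integrable[OF assms(1,3)] edge_integrable[OF assms(2,3)]
  by (simp add: rint_def integral_diff compose_simps)

lemma rint_sum:
  assumes "finite K" "\<And>k. k \<in> K \<Longrightarrow> continuous_on (rect_edges a b) (f k)" "rect a b"
  shows "rint a b (\<lambda>z. \<Sum>k\<in>K. f k z) = (\<Sum>k\<in>K. rint a b (f k))"
  using assms
proof (induction K rule: finite_induct)
  case (insert k K)
  then show ?case by (simp add: rint_add continuous_on_sum)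
qed simp

lemma norm_rint_le:
  assumes "continuous_on (rect_edges a b) f" "rect a b" "\<And>z. z \<in> rect_edges a b \<Longrightarrow> norm (f z) \<le> M"
  shows "norm (rint a b f) \<le> (2 * (Re b - Re a) + norm J * (2 * (Im b - Im a))) * M"
proof -
  have bd: "norm (integral {s..t} k) \<le> M * (t - s)"
    if "s \<le> t" "continuous_on {s..t} k" "\<And>x. x \<in> {s..t} \<Longrightarrow> norm (k x) \<le> M" for s t and k :: "real \<Rightarrow> 'w \<Rightarrow>\<^sub>L 'w"
    by (rule integral_bound) (use that in auto)
  have H: "norm (integral {Re a..Re b} (\<lambda>x. f (Complex x y))) \<le> M * (Re b - Re a)" if "y \<in> {Im a, Im b}" for y
    using assms(2) that
    by (intro bd continuous_on_compose2[OF assms(1)] continuous_intros assms(3))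
       (auto simp: rect_edges_def rect_def)
  have V: "norm (integral {Im a..Im b} (\<lambda>y. f (Complex x y))) \<le> M * (Im b - Im a)" if "x \<in> {Re a, Re b}" for x
    using assms(2) that
    by (intro bd continuous_on_compose2[OF assms(1)] continuous_intros assms(3))
       (auto simp: rect_edges_def rect_def)
  have "norm (rint a b f) \<le> (M * (Re b - Re a) + M * (Re b - Re a))
     + norm J * (M * (Im b - Im a) + M * (Im b - Im a))"
    unfolding rint_def
    by (intro norm_triangle_mono order_trans[OF norm_blinfun_compose] mult_left_mono
        order_trans[OF norm_triangle_ineq4] add_mono H V) auto
  then show ?thesis by (simp add: algebra_simps)
qed

text \<open>The derivative is taken within \<open>S\<close> because a primitive on a closed
  rectangle is only known to be differentiable from inside at the boundary.\<close>

lemma has_integral_horizontal_primitive: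
  assumes "s \<le> t" "\<And>x. x \<in> {s..t} \<Longrightarrow> (W has_field_derivative f (Complex x y)) (at (Complex x y) within S)"
    "\<And>x. x \<in> {s..t} \<Longrightarrow> Complex x y \<in> S"
  shows "((\<lambda>x. f (Complex x y)) has_integral (W (Complex t y) - W (Complex s y))) {s..t}"
proof (rule fundamental_theorem_of_calculus[OF assms(1), of "\<lambda>x. W (Complex x y)"])
  fix x assume x: "x \<in> {s..t}"
  have 1: "((\<lambda>x. Complex x y) has_vector_derivative 1) (at x within {s..t})"
    unfolding Complex_eq
    by (rule has_vector_derivative_real_field[of "\<lambda>z. z + \<i> * of_real y"])
       (auto intro!: derivative_eq_intros)
  have 2: "(W has_field_derivative f (Complex x y)) (at (Complex x y) within (\<lambda>x. Complex x y) ` {s..t})"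
    by (rule DERIV_subset[OF assms(2)[OF x]]) (use assms(3) in auto)
  show "((\<lambda>x. W (Complex x y)) has_vector_derivative f (Complex x y)) (at x within {s..t})"
    using field_vector_diff_chain_within[OF 1 2] by (simp add: o_def)
qed

text \<open>A vertical segment has velocity \<i>, so the primitive integrates
  \<open>\<i> * f\<close>. The compensating factor \<open>- \<i>\<close> is later absorbed by the
  \<open>J\<close> in \<open>rint\<close>.\<close>

lemma has_integral_vertical_primitive:
  assumes "s \<le> t" "\<And>y. y \<in> {s..t} \<Longrightarrow> (W has_field_derivative f (Complex x y)) (at (Complex x y) within S)"
    "\<And>y. y \<in> {s..t} \<Longrightarrow> Complex x y \<in> S"
  shows "((\<lambda>y. f (Complex x y)) has_integral (- \<i> * (W (Complex x t) - W (Complex x s)))) {s..t}"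
proof -
  have "((\<lambda>y. \<i> * f (Complex x y)) has_integral (W (Complex x t) - W (Complex x s))) {s..t}"
  proof (rule fundamental_theorem_of_calculus[OF assms(1), of "\<lambda>y. W (Complex x y)"])
    fix y assume y: "y \<in> {s..t}"
    have 1: "((\<lambda>y. Complex x y) has_vector_derivative \<i>) (at y within {s..t})"
      unfolding Complex_eq
      by (rule has_vector_derivative_real_field[of "\<lambda>z. of_real x + \<i> * z"])
         (auto intro!: derivative_eq_intros)
    have 2: "(W has_field_derivative f (Complex x y)) (at (Complex x y) within (\<lambda>y. Complex x y) ` {s..t})"
      by (rule DERIV_subset[OF assms(2)[OF y]]) (use assms(3) in auto)
    show "((\<lambda>y. W (Complex x y)) has_vector_derivative \<i> * f (Complex x y)) (at y within {s..t})"
      using field_vector_diff_chain_within[OF 1 2] by (simp add: o_def)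
  qed
  from has_integral_mult_right[OF this, of "-\<i>"] show ?thesis by (simp add: mult.assoc[symmetric])
qed

lemma integral_cs:
  assumes "(f has_integral I) X"
  shows "integral X (\<lambda>x. cs (f x) o\<^sub>L A) = cs I o\<^sub>L A"
proof -
  have "bounded_linear (\<lambda>z. cs z o\<^sub>L A)"
    by (rule bounded_linear_compose[OF bounded_linear_compose_left bounded_linear_cs])
  from has_integral_linear[OF assms this] show ?thesis by (simp add: o_def integral_unique)
qed

text \<open>The increments of \<open>W\<close> along the four edges cancel at the corners. A
  primitive on the edges alone suffices, so integrands with a singularity inside, such as higher
  powers of 1/z, are covered.\<close>

lemma rint_primitive:
  assumes "rect a b" "\<And>z. z \<in> rect_edges a b \<Longrightarrow> (W has_field_derivative f z) (at z within S)"
    "rect_edges a b \<subseteq> S"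
  shows "rint a b (\<lambda>z. cs (f z) o\<^sub>L A) = 0"
proof -
  have H: "integral {Re a..Re b} (\<lambda>x. cs (f (Complex x y)) o\<^sub>L A)
      = cs (W (Complex (Re b) y) - W (Complex (Re a) y)) o\<^sub>L A" if "y \<in> {Im a, Im b}" for y
    using assms that
    by (intro integral_cs has_integral_horizontal_primitive[where S = S])
       (auto simp: rect_edges_def rect_def)
  have V: "integral {Im a..Im b} (\<lambda>y. cs (f (Complex x y)) o\<^sub>L A)
      = cs (- \<i> * (W (Complex x (Im b)) - W (Complex x (Im a)))) o\<^sub>L A" if "x \<in> {Re a, Re b}" for x
    using assms that
    by (intro integral_cs has_integral_vertical_primitive[where S = S])
       (auto simp: rect_edges_def rect_def)
  have J: "J o\<^sub>L (cs (- \<i> * w) o\<^sub>L A) = cs w o\<^sub>L A" for w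
    using cs_mult[of \<i> "- \<i> * w"] by (simp add: cs_i blinfun_compose_assoc[symmetric])
  show ?thesis
    by (simp only: rint_def H V J compose_simps(5) insert_iff simp_thms)
       (simp add: cs_diff compose_simps)
qed

text \<open>A closed rectangle is convex, hence \<open>f\<close> has a primitive on all of
  it.\<close>

lemma rint_holomorphic:
  assumes "rect a b" "f holomorphic_on S" "cbox a b \<subseteq> S"
  shows "rint a b (\<lambda>z. cs (f z) o\<^sub>L A) = 0"
proof -
  have hol: "f holomorphic_on cbox a b" using assms holomorphic_on_subset by blast
  have "f field_differentiable at z" if "z \<in> interior (cbox a b) - {}" for z
    using that holomorphic_on_imp_differentiable_at[of f "interior (cbox a b)" z]
      holomorphic_on_subset[OF hol interior_subset] open_box[of a b] by simp
  from holomorphic_convex_primitive[OF convex_box(1) finite.emptyI holomorphic_on_imp_continuous_on[OF hol] this]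
  obtain W where "\<And>z. z \<in> cbox a b \<Longrightarrow> (W has_field_derivative f z) (at z within cbox a b)" by blast
  then show ?thesis
    using rect_edges_subset[OF assms(1)] by (intro rint_primitive[OF assms(1), where W = W and S = "cbox a b"]) auto
qed

text \<open>On each edge \<open>1/z\<close> has a primitive \<open>Ln (u z)\<close> with \<open>u\<close> among \<open>1, \<i>, -1, -\<i>\<close>; by the
  symmetry of the square the four increments agree.\<close>

lemma rint_inverse:
  assumes "b > 0"
  shows "rint (Complex (-b) (-b)) (Complex b b) (\<lambda>z. cs (inverse z) o\<^sub>L A) = cs (2 * of_real pi * \<i>) o\<^sub>L A"
proof -
  define L where "L = Ln (Complex b b) - Ln (Complex b (-b))"
  have A1: "Arg (Complex b b) = pi / 4"
    by (rule Arg_unique[where r = "sqrt 2 * b"])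
       (use assms in \<open>simp_all add: complex_eq_iff Re_exp Im_exp cos_45 sin_45\<close>)
  have pi: "- (pi / 4) \<le> pi" using pi_gt_zero by linarith
  have A2: "Arg (Complex b (-b)) = - (pi / 4)"
    by (rule Arg_unique[where r = "sqrt 2 * b"])
       (use assms pi in \<open>simp_all add: complex_eq_iff Re_exp Im_exp cos_45 sin_45\<close>)
  have nz: "Complex b b \<noteq> 0" "Complex b (-b) \<noteq> 0" using assms by (auto simp: complex_eq_iff)
  have "cmod (Complex b b) = cmod (Complex b (-b))" by (simp add: cmod_def)
  then have L: "L = of_real (pi/2) * \<i>"
    unfolding L_def using nz by (simp add: Ln_Arg A1 A2 diff_divide_distrib)
  \<comment> \<open>The factor \<open>u\<close> turns an edge into the right half plane, away from
    the branch cut of \<open>Ln\<close>.\<close>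
  have D: "((\<lambda>z. Ln (u * z)) has_field_derivative inverse z) (at z)" if "Re (u * z) > 0" "u \<noteq> 0" for u z
  proof -
    have "u * z \<notin> \<real>\<^sub>\<le>\<^sub>0" "z \<noteq> 0" using that by (auto simp: complex_nonpos_Reals_iff)
    moreover have "((\<lambda>z. u * z) has_field_derivative u) (at z)"
      using DERIV_cmult_Id by blast
    ultimately have "((\<lambda>z. Ln (u * z)) has_field_derivative inverse (u * z) * u) (at z)"
      by (intro DERIV_chain2[OF has_field_derivative_Ln])
    then show ?thesis using that(2) by (simp add: field_simps)
  qed
  have 1: "integral {-b..b} (\<lambda>x. cs (inverse (Complex x (-b))) o\<^sub>L A) = cs L o\<^sub>L A"
  proof -
    have "((\<lambda>x. inverse (Complex x (-b))) has_integral
       (Ln (\<i> * Complex b (-b)) - Ln (\<i> * Complex (-b) (-b)))) {-b..b}"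
      by (rule has_integral_horizontal_primitive[where S = UNIV and W = "\<lambda>z. Ln (\<i> * z)"])
         (rule D | simp | use assms in simp)+
    moreover have "\<i> * Complex b (-b) = Complex b b" "\<i> * Complex (-b) (-b) = Complex b (-b)"
      by (auto simp: complex_eq_iff)
    ultimately have "((\<lambda>x. inverse (Complex x (-b))) has_integral L) {-b..b}"
      by (simp only: L_def)
    then show ?thesis by (rule integral_cs)
  qed
  have 2: "integral {-b..b} (\<lambda>x. cs (inverse (Complex x b)) o\<^sub>L A) = cs (-L) o\<^sub>L A"
  proof -
    have "((\<lambda>x. inverse (Complex x b)) has_integral
       (Ln (-\<i> * Complex b b) - Ln (-\<i> * Complex (-b) b))) {-b..b}"
      by (rule has_integral_horizontal_primitive[where S = UNIV and W = "\<lambda>z. Ln (-\<i> * z)"])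
         (rule D | simp | use assms in simp)+
    moreover have "-\<i> * Complex b b = Complex b (-b)" "-\<i> * Complex (-b) b = Complex b b"
      by (auto simp: complex_eq_iff)
    ultimately have "((\<lambda>x. inverse (Complex x b)) has_integral -L) {-b..b}"
      by (simp only: L_def minus_diff_eq)
    then show ?thesis by (rule integral_cs)
  qed
  have 3: "integral {-b..b} (\<lambda>y. cs (inverse (Complex b y)) o\<^sub>L A) = cs (-\<i> * L) o\<^sub>L A"
  proof -
    have "((\<lambda>y. inverse (Complex b y)) has_integral
       (-\<i> * (Ln (1 * Complex b b) - Ln (1 * Complex b (-b))))) {-b..b}"
      by (rule has_integral_vertical_primitive[where S = UNIV and W = "\<lambda>z. Ln (1 * z)"])
         (rule D | simp | use assms in simp)+
    then have "((\<lambda>y. inverse (Complex b y)) has_integral (-\<i> * L)) {-b..b}"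
      by (simp only: L_def mult_1_left)
    then show ?thesis by (rule integral_cs)
  qed
  have 4: "integral {-b..b} (\<lambda>y. cs (inverse (Complex (-b) y)) o\<^sub>L A) = cs (\<i> * L) o\<^sub>L A"
  proof -
    have "((\<lambda>y. inverse (Complex (-b) y)) has_integral
       (-\<i> * (Ln (-1 * Complex (-b) b) - Ln (-1 * Complex (-b) (-b))))) {-b..b}"
      by (rule has_integral_vertical_primitive[where S = UNIV and W = "\<lambda>z. Ln (-1 * z)"])
         (rule D | simp | use assms in simp)+
    moreover have "-1 * Complex (-b) b = Complex b (-b)" "-1 * Complex (-b) (-b) = Complex b b"
      by (auto simp: complex_eq_iff)
    moreover have "- \<i> * (Ln (Complex b (-b)) - Ln (Complex b b)) = \<i> * L"
      by (simp add: L_def algebra_simps)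
    ultimately have "((\<lambda>y. inverse (Complex (-b) y)) has_integral (\<i> * L)) {-b..b}"
      by (simp only:)
    then show ?thesis by (rule integral_cs)
  qed
  \<comment> \<open>Each edge contributes one quarter turn: the left side is
    \<open>4 * L\<close>.\<close>
  have e: "L - (-L) + \<i> * ((-\<i> * L) - \<i> * L) = 2 * of_real pi * \<i>"
    by (simp add: L algebra_simps)
  have "rint (Complex (-b) (-b)) (Complex b b) (\<lambda>z. cs (inverse z) o\<^sub>L A)
    = cs (L - (-L) + \<i> * ((-\<i> * L) - \<i> * L)) o\<^sub>L A"
    unfolding rint_def complex.sel 1 2 3 4 cs_diff cs_add cs_mult[of \<i>] cs_i compose_simps ..
  then show ?thesis unfolding e .
qed

end

text \<open>Fubini needs continuity in both variables jointly, and the diagonal is the critical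
  place. There the mean value inequality for \<open>f u - deriv f z * u\<close> on a small ball
  bounds the deviation of the quotient from \<open>deriv f z\<close> by the oscillation of the
  derivative.\<close>

lemma continuous_on_difference_quotient:
  fixes f :: "complex \<Rightarrow> complex"
  assumes "f holomorphic_on U" "open U"
  shows "continuous_on (U \<times> U) (\<lambda>(z, w). if w = z then deriv f z else (f w - f z) / (w - z))"
    (is "continuous_on _ ?q")
proof -
  have contf: "continuous_on U f" using assms(1) by (rule holomorphic_on_imp_continuous_on)
  have "isCont ?q (z, w)" if zw: "z \<in> U" "w \<in> U" for z w
  proof (cases "w = z")
    case False
    let ?V = "U \<times> U \<inter> {p. snd p \<noteq> fst p}"
    have V: "open ?V"
      by (intro open_Int open_Times assms(2) open_Collect_neq continuous_intros)
    have "continuous_on ?V (\<lambda>p. (f (snd p) - f (fst p)) / (snd p - fst p))"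
      by (intro continuous_intros continuous_on_compose2[OF contf]) auto
    then have "continuous_on ?V ?q"
      by (rule continuous_on_cong[THEN iffD1, rotated 2]) auto
    then show ?thesis
      using V False zw by (simp add: continuous_on_eq_continuous_at)
  next
    case True
    have "isCont (deriv f) z"
      using holomorphic_deriv[OF assms] zw(1) assms(2)
      by (meson continuous_on_eq_continuous_at holomorphic_on_imp_continuous_on)
    show ?thesis
      unfolding True continuous_at_eps_delta
    proof (intro allI impI)
      fix e :: real assume e: "0 < e"
      from \<open>isCont (deriv f) z\<close> e obtain d1 where d1: "d1 > 0"
        "\<And>u. dist u z < d1 \<Longrightarrow> dist (deriv f u) (deriv f z) < e / 2"
        unfolding continuous_at_eps_delta by (metis half_gt_zero)
      obtain d2 where d2: "d2 > 0" "ball z d2 \<subseteq> U" using assms(2) zw(1) openE by blast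
      define d where "d = min d1 d2"
      have bound: "dist (?q (x, y)) (deriv f z) < e" if "x \<in> ball z d" "y \<in> ball z d" for x y
      proof (cases "y = x")
        case True
        then show ?thesis using d1(2)[of x] that e by (simp add: d_def dist_commute)
      next
        case False
        have "cmod ((f y - deriv f z * y) - (f x - deriv f z * x)) \<le> e / 2 * cmod (y - x)"
        proof (rule field_differentiable_bound[of "ball z d" _ "\<lambda>u. deriv f u - deriv f z"])
          fix u assume u: "u \<in> ball z d"
          then have "u \<in> U" using d2(2) by (auto simp: d_def)
          then have "(f has_field_derivative deriv f u) (at u within ball z d)"
            using assms holomorphic_derivI by blast
          then show "((\<lambda>u. f u - deriv f z * u) has_field_derivative deriv f u - deriv f z)
              (at u within ball z d)"
            by (auto intro!: derivative_eq_intros)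
          show "cmod (deriv f u - deriv f z) \<le> e / 2"
            using d1(2)[of u] u by (simp add: d_def dist_norm norm_minus_commute)
        qed (use that in auto)
        moreover have "(f y - f x) / (y - x) - deriv f z
            = ((f y - deriv f z * y) - (f x - deriv f z * x)) / (y - x)"
          using False by (simp add: field_simps)
        ultimately have "cmod ((f y - f x) / (y - x) - deriv f z) \<le> e / 2"
          using False by (simp add: norm_divide divide_le_eq)
        then show ?thesis using False e by (simp add: dist_norm)
      qed
      show "\<exists>d>0. \<forall>p. dist p (z, z) < d \<longrightarrow> dist (?q p) (?q (z, z)) < e"
      proof (intro exI[of _ d] conjI allI impI)
        show "d > 0" using d1 d2 by (simp add: d_def)
        fix p assume "dist p (z, z) < d"
        then have "fst p \<in> ball z d" "snd p \<in> ball z d"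
          using dist_fst_le[of p "(z, z)"] dist_snd_le[of p "(z, z)"] by (auto simp: dist_commute)
        then show "dist (?q p) (?q (z, z)) < e" using bound[of "fst p" "snd p"] by simp
      qed
    qed
  qed
  then show ?thesis
    using assms(2) by (auto simp: continuous_on_eq_continuous_at open_Times)
qed

section \<open>Subdivision of a square into grid cells\<close>

lemma sum_integral_subdivision:
  fixes f :: "real \<Rightarrow> 'a::banach"
  assumes "d \<ge> 0" "continuous_on {s..s + real m * d} f"
  shows "(\<Sum>i<m. integral {s + real i * d..s + real (Suc i) * d} f) = integral {s..s + real m * d} f"
  using assms(2)
proof (induction m)
  case (Suc m)
  have "s + real m * d \<le> s + real (Suc m) * d" using assms(1) by (simp add: algebra_simps)
  then have "continuous_on {s..s + real m * d} f"
    by (intro continuous_on_subset[OF Suc.prems]) auto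
  note IH = Suc.IH[OF this]
  have "integral {s..s + real m * d} f + integral {s + real m * d..s + real (Suc m) * d} f
      = integral {s..s + real (Suc m) * d} f"
    using assms(1) Suc.prems
    by (intro Henstock_Kurzweil_Integration.integral_combine integrable_continuous_real)
       (auto simp: algebra_simps)
  then show ?case using IH by simp
qed simp

definition grid_point :: "complex \<Rightarrow> real \<Rightarrow> nat \<Rightarrow> nat \<Rightarrow> complex" where
  "grid_point c d i j = Complex (Re c + real i * d) (Im c + real j * d)"

lemma grid_point_sel [simp]:
  "Re (grid_point c d i j) = Re c + real i * d" "Im (grid_point c d i j) = Im c + real j * d"
  by (simp_all add: grid_point_def)

lemma rect_grid_cell: "d \<ge> 0 \<Longrightarrow> rect (grid_point c d i j) (grid_point c d (Suc i) (Suc j))"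
  by (auto simp: rect_def algebra_simps)

lemma grid_cell_subset:
  assumes "d \<ge> 0" "i < m" "j < m"
  shows "cbox (grid_point c d i j) (grid_point c d (Suc i) (Suc j)) \<subseteq> cbox c (grid_point c d m m)"
proof -
  have "real (Suc i) * d \<le> real m * d" "real (Suc j) * d \<le> real m * d" "0 \<le> real i * d" "0 \<le> real j * d"
    using assms by (intro mult_right_mono mult_nonneg_nonneg; simp)+
  then show ?thesis by (auto simp: in_cbox_complex_iff simp del: of_nat_Suc)
qed

context complex_structure
begin

text \<open>Neighbouring cells traverse their common edge in opposite directions. For the edge
  integrals \<open>h\<close> and \<open>v\<close> this cancellation is a telescoping sum, in
  \<open>j\<close> for horizontal and in \<open>i\<close> for vertical edges.\<close>

lemma sum_rint_grid:
  assumes d: "d \<ge> 0" and g: "continuous_on (cbox c (grid_point c d m m)) g"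
  shows "(\<Sum>i<m. \<Sum>j<m. rint (grid_point c d i j) (grid_point c d (Suc i) (Suc j)) g)
    = rint c (grid_point c d m m) g"
proof -
  define x where "x i = Re c + real i * d" for i
  define y where "y j = Im c + real j * d" for j
  define h where "h i j = integral {x i..x (Suc i)} (\<lambda>t. g (Complex t (y j)))" for i j
  define v where "v i j = integral {y j..y (Suc j)} (\<lambda>t. g (Complex (x i) t))" for i j
  have le: "real i * d \<le> real m * d" if "i \<le> m" for i
    using that d by (intro mult_right_mono) auto
  have h: "(\<Sum>i<m. h i j) = integral {Re c..x m} (\<lambda>t. g (Complex t (y j)))" if "j \<le> m" for j
    unfolding h_def x_def
    using le[OF that] d
    by (intro sum_integral_subdivision d continuous_on_compose2[OF g] continuous_intros)
       (auto simp: in_cbox_complex_iff y_def)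
  have v: "(\<Sum>j<m. v i j) = integral {Im c..y m} (\<lambda>t. g (Complex (x i) t))" if "i \<le> m" for i
    unfolding v_def y_def
    using le[OF that] d
    by (intro sum_integral_subdivision d continuous_on_compose2[OF g] continuous_intros)
       (auto simp: in_cbox_complex_iff x_def)
  have "(\<Sum>i<m. \<Sum>j<m. rint (grid_point c d i j) (grid_point c d (Suc i) (Suc j)) g)
      = (\<Sum>i<m. \<Sum>j<m. (h i j - h i (Suc j)) + (J o\<^sub>L (v (Suc i) j - v i j)))"
    by (simp add: rint_def h_def v_def x_def y_def)
  also have "\<dots> = (\<Sum>i<m. \<Sum>j<m. h i j - h i (Suc j))
      + (J o\<^sub>L (\<Sum>i<m. \<Sum>j<m. v (Suc i) j - v i j))"
    by (simp add: sum.distrib compose_sum_right)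
  also have "(\<Sum>i<m. \<Sum>j<m. h i j - h i (Suc j)) = (\<Sum>j<m. (\<Sum>i<m. h i j) - (\<Sum>i<m. h i (Suc j)))"
    by (subst sum.swap) (simp add: sum_subtractf)
  also have "\<dots> = (\<Sum>i<m. h i 0) - (\<Sum>i<m. h i m)"
    by (rule sum_lessThan_telescope')
  also have "(\<Sum>i<m. \<Sum>j<m. v (Suc i) j - v i j) = (\<Sum>i<m. (\<Sum>j<m. v (Suc i) j) - (\<Sum>j<m. v i j))"
    by (simp add: sum_subtractf)
  also have "\<dots> = (\<Sum>j<m. v m j) - (\<Sum>j<m. v 0 j)"
    by (rule sum_lessThan_telescope)
  finally show ?thesis
    by (simp add: h v rint_def) (simp add: x_def y_def)
qed

section \<open>Fubini, parameters and reflection for rectangle integrals\<close>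

lemma integral_rint_swap:
  fixes s t :: real
  assumes k: "continuous_on (K \<times> cbox c d) (\<lambda>(z, w). k z w)"
    and p: "continuous_on {s..t} p" "p ` {s..t} \<subseteq> K" and cd: "rect c d"
  shows "integral {s..t} (\<lambda>x. rint c d (k (p x))) = rint c d (\<lambda>w. integral {s..t} (\<lambda>x. k (p x) w))"
proof -
  have cont: "continuous_on ({s..t} \<times> {u..v}) (\<lambda>(x, y). k (p x) (e y))"
    if "continuous_on {u..v} e" "e ` {u..v} \<subseteq> cbox c d" for u v and e :: "real \<Rightarrow> complex"
    unfolding split_def
    by (rule continuous_on_compose2[OF k[unfolded split_def], of _ "\<lambda>q. (p (fst q), e (snd q))", simplified])
       (use p that in \<open>auto intro!: continuous_on_Pair continuous_on_compose2[OF p(1)]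
          continuous_on_compose2[OF that(1)] continuous_intros\<close>)
  have swap: "integral {s..t} (\<lambda>x. integral {u..v} (\<lambda>y. k (p x) (e y)))
      = integral {u..v} (\<lambda>y. integral {s..t} (\<lambda>x. k (p x) (e y)))"
    and int: "(\<lambda>x. integral {u..v} (\<lambda>y. k (p x) (e y))) integrable_on {s..t}"
    if "continuous_on {u..v} e" "e ` {u..v} \<subseteq> cbox c d" for u v and e :: "real \<Rightarrow> complex"
  proof -
    show "integral {s..t} (\<lambda>x. integral {u..v} (\<lambda>y. k (p x) (e y)))
      = integral {u..v} (\<lambda>y. integral {s..t} (\<lambda>x. k (p x) (e y)))"
      using integral_swap_continuous[of s u t v "\<lambda>x y. k (p x) (e y)"] cont[OF that]
      unfolding cbox_Pair_eq box_real by blast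
    show "(\<lambda>x. integral {u..v} (\<lambda>y. k (p x) (e y))) integrable_on {s..t}"
      using integral_continuous_on_param[of "{s..t}" u v "\<lambda>x y. k (p x) (e y)"] cont[OF that]
      by (intro integrable_continuous_real) simp
  qed
  have H: "continuous_on {Re c..Re d} (\<lambda>x. Complex x y)" "continuous_on {Im c..Im d} (\<lambda>y. Complex x y)" for x y
    by (intro continuous_intros)+
  have I: "(\<lambda>x. Complex x (Im c)) ` {Re c..Re d} \<subseteq> cbox c d" "(\<lambda>x. Complex x (Im d)) ` {Re c..Re d} \<subseteq> cbox c d"
    "(\<lambda>y. Complex (Re c) y) ` {Im c..Im d} \<subseteq> cbox c d" "(\<lambda>y. Complex (Re d) y) ` {Im c..Im d} \<subseteq> cbox c d"
    using cd by (auto simp: in_cbox_complex_iff rect_def)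
  note ints = int[OF H(1) I(1)] int[OF H(1) I(2)] int[OF H(2) I(3)] int[OF H(2) I(4)]
  have JJ: "integral {s..t} (\<lambda>x. J o\<^sub>L f x) = J o\<^sub>L integral {s..t} f" if "f integrable_on {s..t}" for f
    using integral_linear[OF that bounded_linear_compose_right] by (simp add: o_def)
  have Ji: "(\<lambda>x. J o\<^sub>L f x) integrable_on {s..t}" if "f integrable_on {s..t}" for f
    using integrable_linear[OF that bounded_linear_compose_right] by (simp add: o_def)
  have "integral {s..t} (\<lambda>x. rint c d (k (p x))) =
     (integral {s..t} (\<lambda>x. integral {Re c..Re d} (\<lambda>y. k (p x) (Complex y (Im c))))
       - integral {s..t} (\<lambda>x. integral {Re c..Re d} (\<lambda>y. k (p x) (Complex y (Im d)))))
     + (J o\<^sub>L (integral {s..t} (\<lambda>x. integral {Im c..Im d} (\<lambda>y. k (p x) (Complex (Re d) y)))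
       - integral {s..t} (\<lambda>x. integral {Im c..Im d} (\<lambda>y. k (p x) (Complex (Re c) y)))))"
    unfolding rint_def
    by (subst integral_add) (use ints in \<open>simp_all add: integral_diff integrable_diff JJ Ji\<close>)
  then show ?thesis
    by (simp only: rint_def swap[OF H(1) I(1)] swap[OF H(1) I(2)] swap[OF H(2) I(3)] swap[OF H(2) I(4)])
qed

lemma continuous_on_rint_param:
  assumes k: "continuous_on (K \<times> cbox c d) (\<lambda>(z, w). k z w)" and cd: "rect c d"
  shows "continuous_on K (\<lambda>z. rint c d (k z))"
proof -
  have *: "continuous_on K (\<lambda>z. integral {u..v} (\<lambda>y. k z (e y)))"
    if "continuous_on {u..v} e" "e ` {u..v} \<subseteq> cbox c d" for u v and e :: "real \<Rightarrow> complex"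
  proof -
    have "continuous_on (K \<times> {u..v}) (\<lambda>(x, y). k x (e y))"
      unfolding split_def
      by (rule continuous_on_compose2[OF k[unfolded split_def], of _ "\<lambda>q. (fst q, e (snd q))", simplified])
         (use that in \<open>auto intro!: continuous_on_Pair
            continuous_on_compose2[OF that(1)] continuous_intros\<close>)
    then show ?thesis
      using integral_continuous_on_param[of K u v "\<lambda>x y. k x (e y)"] by simp
  qed
  show ?thesis
    unfolding rint_def using cd
    by (intro continuous_intros * ) (auto simp: in_cbox_complex_iff rect_def)
qed

text \<open>Each edge of the rectangle from \<open>a\<close> to \<open>b\<close> is swapped
  separately by \<open>integral_rint_swap\<close>. The \<open>J\<close> belonging to its vertical
  edges passes through the other integral because it commutes with itself.\<close>

lemma rint_rint_swap:
  assumes k: "continuous_on (cbox a b \<times> cbox c d) (\<lambda>(z, w). k z w)" and ab: "rect a b" and cd: "rect c d"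
  shows "rint a b (\<lambda>z. rint c d (\<lambda>w. k z w)) = rint c d (\<lambda>w. rint a b (\<lambda>z. k z w))"
proof -
  have H: "continuous_on {Re a..Re b} (\<lambda>x. Complex x y)" "continuous_on {Im a..Im b} (\<lambda>y. Complex x y)" for x y
    by (intro continuous_intros)+
  have I: "(\<lambda>x. Complex x (Im a)) ` {Re a..Re b} \<subseteq> cbox a b" "(\<lambda>x. Complex x (Im b)) ` {Re a..Re b} \<subseteq> cbox a b"
    "(\<lambda>y. Complex (Re a) y) ` {Im a..Im b} \<subseteq> cbox a b" "(\<lambda>y. Complex (Re b) y) ` {Im a..Im b} \<subseteq> cbox a b"
    using ab by (auto simp: in_cbox_complex_iff rect_def)
  have cont: "continuous_on (rect_edges c d) (\<lambda>w. integral {u..v} (\<lambda>y. k (e y) w))"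
    if "continuous_on {u..v} e" "e ` {u..v} \<subseteq> cbox a b" for u v and e :: "real \<Rightarrow> complex"
  proof -
    have "continuous_on (rect_edges c d \<times> {u..v}) (\<lambda>(w, y). k (e y) w)"
      unfolding split_def
      by (rule continuous_on_compose2[OF k[unfolded split_def], of _ "\<lambda>q. (e (snd q), fst q)", simplified])
         (use that rect_edges_subset[OF cd] in \<open>auto intro!: continuous_on_Pair
            continuous_on_compose2[OF that(1)] continuous_intros\<close>)
    then show ?thesis
      using integral_continuous_on_param[of "rect_edges c d" u v "\<lambda>w y. k (e y) w"] by simp
  qed
  note c = cont[OF H(1) I(1)] cont[OF H(1) I(2)] cont[OF H(2) I(3)] cont[OF H(2) I(4)]
  have "rint c d (\<lambda>w. rint a b (\<lambda>z. k z w)) =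
    (rint c d (\<lambda>w. integral {Re a..Re b} (\<lambda>x. k (Complex x (Im a)) w))
     - rint c d (\<lambda>w. integral {Re a..Re b} (\<lambda>x. k (Complex x (Im b)) w)))
    + (J o\<^sub>L (rint c d (\<lambda>w. integral {Im a..Im b} (\<lambda>y. k (Complex (Re b) y) w))
     - rint c d (\<lambda>w. integral {Im a..Im b} (\<lambda>y. k (Complex (Re a) y) w))))"
    unfolding rint_def[of a b]
    by (subst rint_add, intro continuous_intros c, intro continuous_intros c, rule cd)
       (simp add: rint_diff rint_compose_left c cd continuous_on_diff)
  also have "\<dots> = rint a b (\<lambda>z. rint c d (k z))"
    unfolding rint_def[of a b]
    by (simp only: integral_rint_swap[OF k H(1) I(1) cd] integral_rint_swap[OF k H(1) I(2) cd]
       integral_rint_swap[OF k H(2) I(3) cd] integral_rint_swap[OF k H(2) I(4) cd])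
  finally show ?thesis by simp
qed

text \<open>The sign is the reversal of orientation under reflection. For the horizontal edges it
  arises because top and bottom are exchanged, for the vertical ones because \<open>S\<close>
  anticommutes with \<open>J\<close>.\<close>

lemma rint_conjugate:
  assumes S: "S o\<^sub>L J = - (J o\<^sub>L S)" and ab: "rect a b"
    and g: "continuous_on (cbox (Complex (Re a) (- Im b)) (Complex (Re b) (- Im a))) g"
  shows "rint a b (\<lambda>z. S o\<^sub>L g (cnj z) o\<^sub>L S)
    = - (S o\<^sub>L rint (Complex (Re a) (- Im b)) (Complex (Re b) (- Im a)) g o\<^sub>L S)"
proof -
  let ?a = "Complex (Re a) (- Im b)" and ?b = "Complex (Re b) (- Im a)"
  have r: "rect ?a ?b" using ab by (simp add: rect_def)
  have "continuous_on (rect_edges ?a ?b) g"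
    by (rule continuous_on_subset[OF g rect_edges_subset[OF r]])
  note ints = edge_integrable[OF this r, simplified]
  have bl: "bounded_linear (\<lambda>A. S o\<^sub>L A o\<^sub>L S)"
    by (intro bounded_linear_compose[OF bounded_linear_compose_left] bounded_linear_compose_right)
  have lin: "integral X (\<lambda>x. S o\<^sub>L f x o\<^sub>L S) = S o\<^sub>L integral X f o\<^sub>L S" if "f integrable_on X" for f and X :: "real set"
    using integral_linear[OF that bl] by (simp add: o_def)
  have reflect: "integral {Im a..Im b} (\<lambda>y. S o\<^sub>L g (Complex x (- y)) o\<^sub>L S)
      = integral {- Im b..- Im a} (\<lambda>y. S o\<^sub>L g (Complex x y) o\<^sub>L S)" for x
    using integral_reflect[of "- Im a" "- Im b" "\<lambda>y. S o\<^sub>L g (Complex x y) o\<^sub>L S"] by simp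
  have SJ: "J o\<^sub>L (S o\<^sub>L X) = - (S o\<^sub>L (J o\<^sub>L X))" for X :: "'w \<Rightarrow>\<^sub>L 'w"
    using S by (metis (no_types) blinfun_compose_assoc compose_simps(6) minus_minus)
  have C: "cnj (Complex x y) = Complex x (- y)" for x y by (simp add: complex_eq_iff)
  show ?thesis
    using ints by (simp add: rint_def C reflect lin) (simp add: compose_simps SJ)
qed

end

subsection \<open>Resolvents\<close>

definition blinfun_power :: "('a::real_normed_vector \<Rightarrow>\<^sub>L 'a) \<Rightarrow> nat \<Rightarrow> 'a \<Rightarrow>\<^sub>L 'a" where
  "blinfun_power A k = ((\<lambda>B. A o\<^sub>L B) ^^ k) id_blinfun"

lemma blinfun_power_0 [simp]: "blinfun_power A 0 = id_blinfun"
  and blinfun_power_Suc [simp]: "blinfun_power A (Suc k) = A o\<^sub>L blinfun_power A k"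
  by (simp_all add: blinfun_power_def)

lemma blinfun_power_commute:
  "B o\<^sub>L A = A o\<^sub>L B \<Longrightarrow> B o\<^sub>L blinfun_power A k = blinfun_power A k o\<^sub>L B"
proof (induction k)
  case (Suc k)
  then show ?case by (metis blinfun_compose_assoc blinfun_power_Suc)
qed simp

lemma blinfun_power_apply: "blinfun_apply (blinfun_power A k) x = (blinfun_apply A ^^ k) x"
  by (induction k) simp_all

lemma norm_blinfun_power_le: "norm (blinfun_power A k) \<le> norm A ^ k"
proof (induction k)
  case (Suc k)
  then show ?case
    using norm_blinfun_compose[of A "blinfun_power A k"] mult_left_mono[OF Suc norm_ge_zero[of A]] by simp
qed (simp add: norm_blinfun_id_le)

definition blinfun_inverts :: "('a::real_normed_vector \<Rightarrow>\<^sub>L 'a) \<Rightarrow> ('a \<Rightarrow>\<^sub>L 'a) \<Rightarrow> bool" where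
  "blinfun_inverts A B \<longleftrightarrow> A o\<^sub>L B = id_blinfun \<and> B o\<^sub>L A = id_blinfun"

lemma neumann_series:
  fixes A :: "'a::banach \<Rightarrow>\<^sub>L 'a"
  assumes "norm A < 1"
  shows "\<exists>B. blinfun_inverts (id_blinfun - A) B"
proof -
  have "summable (\<lambda>k. norm A ^ k)" using assms by (simp add: summable_geometric)
  then have s: "summable (blinfun_power A)"
    by (rule summable_comparison_test'[where N = 0]) (simp add: norm_blinfun_power_le)
  define B where "B = suminf (blinfun_power A)"
  have "blinfun_power A sums B" using s by (simp add: B_def summable_sums)
  then have l: "(\<lambda>k. A o\<^sub>L blinfun_power A k) sums (A o\<^sub>L B)" and r: "(\<lambda>k. blinfun_power A k o\<^sub>L A) sums (B o\<^sub>L A)"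
    by (auto intro: bounded_linear.sums[OF bounded_linear_compose_right] bounded_linear.sums[OF bounded_linear_compose_left])
  have "(\<lambda>k. blinfun_power A (Suc k)) sums (B - id_blinfun)"
    using \<open>blinfun_power A sums B\<close> sums_Suc_iff[of "blinfun_power A"] by simp
  then have "A o\<^sub>L B = B - id_blinfun" "B o\<^sub>L A = B - id_blinfun"
    using l r blinfun_power_commute[of A A] by (auto intro: sums_unique2)
  then show ?thesis
    unfolding blinfun_inverts_def by (intro exI[of _ B]) (simp add: compose_simps)
qed

lemma blinfun_inverts_compose:
  "blinfun_inverts A A' \<Longrightarrow> blinfun_inverts B B' \<Longrightarrow> blinfun_inverts (A o\<^sub>L B) (B' o\<^sub>L A')"
  unfolding blinfun_inverts_def by (metis blinfun_compose_assoc id_blinfun_compose(1))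

text \<open>A finite geometric expansion with explicit remainder. It is used for the resolvent both
  near a regular point and for large arguments.\<close>

lemma fixed_point_expansion:
  assumes "X = A + (u o\<^sub>L X)"
  shows "X = (\<Sum>k<n. blinfun_power u k o\<^sub>L A) + (blinfun_power u n o\<^sub>L X)"
proof (induction n)
  case (Suc n)
  have "blinfun_power u n o\<^sub>L X = (blinfun_power u n o\<^sub>L A) + (blinfun_power u (Suc n) o\<^sub>L X)"
    by (subst assms)
       (simp only: compose_simps(3) blinfun_power_Suc blinfun_power_commute[of u u n, OF refl] blinfun_compose_assoc)
  then show ?case using Suc by (simp add: add.assoc)
qed simp

text \<open>In the applications \<open>x\<close> is a distance, which excludes \<open>x < 0\<close>.
  The \<open>+ 1\<close> in the witness avoids a division by zero for \<open>K = 0\<close>.\<close>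

lemma near_zero_mult:
  assumes "e > (0::real)" shows "\<exists>d>0. \<forall>x. x < d \<longrightarrow> K * x < e \<or> x < 0"
proof -
  have "K * x < e \<or> x < 0" if "x < e / (\<bar>K\<bar> + 1)" for x
  proof (cases "x < 0")
    case False
    have "K * x \<le> \<bar>K\<bar> * x" using False by (intro mult_right_mono) auto
    also have "\<dots> \<le> (\<bar>K\<bar> + 1) * x" using False by (intro mult_right_mono) auto
    also have "\<dots> < e" using that by (simp add: pos_less_divide_eq mult.commute)
    finally show ?thesis by blast
  qed simp
  then show ?thesis using assms by (intro exI[of _ "e / (\<bar>K\<bar> + 1)"]) (auto intro: divide_pos_pos)
qed

text \<open>Turns remainder estimates for every truncation order into an equality, so that no
  infinite series has to be integrated term by term.\<close>

lemma tendsto_zero_imp_eq: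
  fixes x y :: "'a::real_normed_vector"
  assumes "\<And>n::nat. norm (x - y) \<le> K * q ^ n" "\<bar>q\<bar> < (1::real)"
  shows "x = y"
proof -
  have "(\<lambda>n. K * q ^ n) \<longlonglongrightarrow> K * 0"
    using assms(2) by (intro tendsto_mult tendsto_const LIMSEQ_power_zero) auto
  then have "norm (x - y) \<le> K * 0"
    using assms(1) by (intro LIMSEQ_le_const) auto
  then show ?thesis by simp
qed

section \<open>Spectrum and resolvent of an operator commuting with \<open>J\<close>\<close>

locale complex_operator = complex_structure J for J :: "'w::banach \<Rightarrow>\<^sub>L 'w" +
  fixes T :: "'w \<Rightarrow>\<^sub>L 'w"
  assumes J_T: "J o\<^sub>L T = T o\<^sub>L J"
begin

text \<open>The inverse ranges over all bounded real linear operators; that it commutes with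
  \<open>J\<close> is automatic, by \<open>J_res\<close>.\<close>

definition spec :: "complex set" where
  "spec = {z. \<not> (\<exists>B. blinfun_inverts (cs z - T) B)}"

definition res :: "complex \<Rightarrow> 'w \<Rightarrow>\<^sub>L 'w" where
  "res z = (SOME B. blinfun_inverts (cs z - T) B)"

lemma cs_T: "cs z o\<^sub>L T = T o\<^sub>L cs z"
  by (rule cs_commute[OF J_T])

lemma T_cs_left: "T o\<^sub>L (cs z o\<^sub>L X) = cs z o\<^sub>L (T o\<^sub>L X)"
  by (metis blinfun_compose_assoc cs_T)

lemma res_inverts: "z \<notin> spec \<Longrightarrow> blinfun_inverts (cs z - T) (res z)"
  unfolding spec_def res_def by (auto intro: someI)

lemma res_right: "z \<notin> spec \<Longrightarrow> (cs z - T) o\<^sub>L res z = id_blinfun"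
  and res_left: "z \<notin> spec \<Longrightarrow> res z o\<^sub>L (cs z - T) = id_blinfun"
  using res_inverts unfolding blinfun_inverts_def by blast+

lemma res_commute:
  assumes "z \<notin> spec" "J o\<^sub>L B = B o\<^sub>L J" "T o\<^sub>L B = B o\<^sub>L T"
  shows "res z o\<^sub>L B = B o\<^sub>L res z"
proof -
  have "(cs z - T) o\<^sub>L B = B o\<^sub>L (cs z - T)"
    using assms cs_commute[OF assms(2)] by (simp add: compose_simps)
  then show ?thesis
    by (metis assms(1) blinfun_compose_assoc id_blinfun_compose res_left res_right)
qed

lemma J_res: "z \<notin> spec \<Longrightarrow> J o\<^sub>L res z = res z o\<^sub>L J"
  using res_commute[of z J] J_T by simp

text \<open>Stated as a fixed point equation for \<open>res z\<close>, the form that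
  \<open>fixed_point_expansion\<close> iterates.\<close>

lemma resolvent_identity:
  assumes "z \<notin> spec" "c \<notin> spec"
  shows "res z = res c + (cs (c - z) o\<^sub>L (res c o\<^sub>L res z))"
proof -
  have comm: "res c o\<^sub>L (cs z - T) = (cs z - T) o\<^sub>L res c"
    by (rule res_commute[OF assms(2)]) (simp_all add: compose_simps J_T J_cs_commute cs_T)
  have "cs (c - z) = (cs c - T) - (cs z - T)" by (simp add: cs_diff)
  then have "cs (c - z) o\<^sub>L (res c o\<^sub>L res z)
      = ((cs c - T) o\<^sub>L (res c o\<^sub>L res z)) - ((cs z - T) o\<^sub>L (res c o\<^sub>L res z))"
    by (simp only: compose_simps(4))
  also have "(cs c - T) o\<^sub>L (res c o\<^sub>L res z) = res z"
    by (metis assms(2) blinfun_compose_assoc id_blinfun_compose(1) res_right)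
  also have "(cs z - T) o\<^sub>L (res c o\<^sub>L res z) = res c"
    by (metis assms(1) comm blinfun_compose_assoc id_blinfun_compose(2) res_right)
  finally show ?thesis by simp
qed

text \<open>Factor z - T = z (1 - T/z) and invert the second factor by a Neumann series.\<close>

lemma not_spec_large:
  assumes "cmod z > cs_bound * norm T"
  shows "z \<notin> spec"
proof -
  have "z \<noteq> 0" using assms cs_bound_ge_1 norm_ge_zero[of T]
    by (metis mult_nonneg_nonneg norm_zero not_less order_trans zero_le_one)
  have "norm (cs (inverse z) o\<^sub>L T) \<le> cs_bound * cmod (inverse z) * norm T" by (rule norm_cs_compose_le)
  also have "\<dots> = cs_bound * norm T / cmod z" by (simp add: norm_inverse divide_inverse ac_simps)
  also have "\<dots> < 1" using assms \<open>z \<noteq> 0\<close> by (simp add: pos_divide_less_eq)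
  finally obtain B where B: "blinfun_inverts (id_blinfun - (cs (inverse z) o\<^sub>L T)) B" using neumann_series by blast
  have i: "blinfun_inverts (cs z) (cs (inverse z))"
    using \<open>z \<noteq> 0\<close> cs_mult[of z "inverse z"] cs_mult[of "inverse z" z] by (simp add: blinfun_inverts_def)
  have "cs z o\<^sub>L (id_blinfun - (cs (inverse z) o\<^sub>L T)) = cs z - T"
    using \<open>z \<noteq> 0\<close> by (simp add: compose_simps cs_cancel)
  then show ?thesis
    using blinfun_inverts_compose[OF i B] unfolding spec_def by auto
qed

text \<open>Factor z - T = (1 + (z - c) \<open>res c\<close>) (c - T) and invert the first factor by
  a Neumann series.\<close>

lemma not_spec_near:
  assumes "c \<notin> spec" "cs_bound * cmod (z - c) * norm (res c) < 1"
  shows "z \<notin> spec"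
proof -
  have "norm (- (cs (z - c) o\<^sub>L res c)) < 1"
    using norm_cs_compose_le[of "z - c" "res c"] assms(2) by simp
  then obtain B where B: "blinfun_inverts (id_blinfun - (- (cs (z - c) o\<^sub>L res c))) B" using neumann_series by blast
  have "id_blinfun - (- (cs (z - c) o\<^sub>L res c)) o\<^sub>L (cs c - T)
      = (cs c - T) + (cs (z - c) o\<^sub>L (res c o\<^sub>L (cs c - T)))"
    by (simp only: diff_minus_eq_add compose_simps(1,2) id_blinfun_compose)
  also have "\<dots> = cs z - T" by (simp add: res_left[OF assms(1)] cs_diff)
  finally have "id_blinfun - (- (cs (z - c) o\<^sub>L res c)) o\<^sub>L (cs c - T) = cs z - T" .
  then show ?thesis
    using blinfun_inverts_compose[OF B res_inverts[OF assms(1)]] unfolding spec_def by auto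
qed

lemma spec_bounded: "spec \<subseteq> cball 0 (cs_bound * norm T)"
  using not_spec_large by (auto simp: not_less[symmetric])

lemma open_resolvent: "open (- spec)"
proof (rule openI)
  fix c assume "c \<in> - spec"
  obtain d where "d > 0" "\<And>x. x < d \<Longrightarrow> (cs_bound * norm (res c)) * x < 1 \<or> x < 0"
    using near_zero_mult[of 1 "cs_bound * norm (res c)"] by auto
  then have "z \<notin> spec" if "dist z c < d" for z
    using not_spec_near[of c z] \<open>c \<in> - spec\<close> that by (force simp: dist_norm algebra_simps)
  then show "\<exists>d>0. ball c d \<subseteq> - spec" using \<open>d > 0\<close> by (auto simp: dist_commute)
qed

lemma compact_spec: "compact spec"
  using open_resolvent spec_bounded bounded_subset bounded_cball
  by (metis closed_open compact_eq_bounded_closed)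

text \<open>The resolvent identity bounds the difference by \<open>K * x * norm (res z)\<close>,
  which still contains the unknown \<open>res z\<close>. Where \<open>K * x < 1 / 2\<close>, this
  very bound yields \<open>norm (res z) \<le> 2 * norm (res c)\<close>, and inserting that makes the
  difference small.\<close>

lemma continuous_on_res: "continuous_on (- spec) res"
proof -
  have "isCont res c" if c: "c \<notin> spec" for c
    unfolding continuous_at_eps_delta
  proof (intro allI impI)
    fix e :: real assume e: "e > 0"
    define K where "K = cs_bound * norm (res c)"
    have K: "K \<ge> 0" using cs_bound_ge_1 by (simp add: K_def)
    obtain d1 where d1: "d1 > 0" "\<And>x. x < d1 \<Longrightarrow> K * x < 1 / 2 \<or> x < 0"
      using near_zero_mult[of "1/2" K] by auto
    obtain d2 where d2: "d2 > 0" "\<And>x. x < d2 \<Longrightarrow> (K * (2 * norm (res c))) * x < e \<or> x < 0"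
      using near_zero_mult[of e "K * (2 * norm (res c))"] e by auto
    have "dist (res z) (res c) < e" if z: "dist z c < min d1 d2" for z
    proof -
      define x where "x = cmod (z - c)"
      have x: "x \<ge> 0" "K * x < 1 / 2" "K * (2 * norm (res c)) * x < e"
        using d1(2)[of x] d2(2)[of x] z by (auto simp: x_def dist_norm)
      have "z \<notin> spec" using not_spec_near[OF c, of z] x by (auto simp: K_def x_def algebra_simps)
      have "norm (cs (c - z) o\<^sub>L (res c o\<^sub>L res z)) \<le> cs_bound * cmod (c - z) * norm (res c o\<^sub>L res z)"
        by (rule norm_cs_compose_le)
      also have "\<dots> \<le> cs_bound * cmod (c - z) * (norm (res c) * norm (res z))"
        using cs_bound_ge_1 by (intro mult_left_mono norm_blinfun_compose) auto
      also have "cs (c - z) o\<^sub>L (res c o\<^sub>L res z) = res z - res c"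
        using resolvent_identity[OF \<open>z \<notin> spec\<close> c] by (metis add_diff_cancel_left')
      finally have n: "norm (res z - res c) \<le> K * x * norm (res z)"
        by (simp add: K_def x_def norm_minus_commute ac_simps)
      also have "\<dots> \<le> 1 / 2 * norm (res z)" using x by (intro mult_right_mono) auto
      finally have "norm (res z) \<le> 2 * norm (res c)"
        using norm_triangle_ineq2[of "res z" "res c"] by linarith
      then have "K * x * norm (res z) \<le> K * x * (2 * norm (res c))"
        using K x by (intro mult_left_mono) auto
      then show ?thesis using n x by (simp add: dist_norm algebra_simps)
    qed
    then show "\<exists>d>0. \<forall>z. dist z c < d \<longrightarrow> dist (res z) (res c) < e"
      using d1 d2 by (intro exI[of _ "min d1 d2"]) auto
  qed
  then show ?thesis using open_resolvent by (simp add: continuous_on_eq_continuous_at)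
qed

lemma blinfun_power_T_cs: "blinfun_power T k o\<^sub>L cs w = cs w o\<^sub>L blinfun_power T k"
  by (rule blinfun_power_commute[OF cs_T, symmetric])

lemma blinfun_power_cs:
  "J o\<^sub>L B = B o\<^sub>L J \<Longrightarrow> blinfun_power (cs w o\<^sub>L B) k = cs (w ^ k) o\<^sub>L blinfun_power B k"
proof (induction k)
  case (Suc k)
  have "B o\<^sub>L (cs w' o\<^sub>L X) = cs w' o\<^sub>L (B o\<^sub>L X)" for w' and X :: "'w \<Rightarrow>\<^sub>L 'w"
    using cs_commute[OF Suc.prems] by (metis blinfun_compose_assoc)
  then show ?case using Suc by (simp add: compose_simps cs_mult)
qed simp

text \<open>Collecting the scalars in a single \<open>cs (w ^ n)\<close> lets
  \<open>cs_bound\<close> enter once rather than \<open>n\<close> times, so that smallness of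
  \<open>cmod w * norm B\<close> alone gives geometric decay.\<close>

lemma norm_remainder_le:
  assumes "cmod w * norm B \<le> q"
  shows "norm (cs (w ^ n) o\<^sub>L blinfun_power B n o\<^sub>L X) \<le> cs_bound * norm X * q ^ n"
proof -
  have "norm (cs (w ^ n) o\<^sub>L blinfun_power B n o\<^sub>L X) \<le> norm (cs (w ^ n) o\<^sub>L blinfun_power B n) * norm X"
    by (rule norm_blinfun_compose)
  also have "\<dots> \<le> (cs_bound * cmod (w ^ n) * norm B ^ n) * norm X"
    using cs_bound_ge_1
    by (intro mult_right_mono order_trans[OF norm_cs_compose_le] mult_left_mono norm_blinfun_power_le) auto
  also have "\<dots> = cs_bound * (cmod w * norm B) ^ n * norm X" by (simp add: norm_power power_mult_distrib)
  also have "\<dots> \<le> cs_bound * q ^ n * norm X"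
    using assms cs_bound_ge_1 by (intro mult_right_mono mult_left_mono power_mono) auto
  finally show ?thesis by (simp add: ac_simps)
qed

text \<open>The resolvent is a polynomial in \<open>c - z\<close> up to a remainder of size \<open>q\<^sup>n\<close>, and polynomials
  integrate to zero.\<close>

lemma rint_res_outside:
  assumes ab: "rect a b" and out: "cbox a b \<inter> spec = {}" and c: "c \<in> cbox a b"
    and small: "\<And>z. z \<in> rect_edges a b \<Longrightarrow> cmod (c - z) * norm (res c) \<le> q" and q: "0 \<le> q" "q < 1"
  shows "rint a b res = 0"
proof -
  have edges: "rect_edges a b \<subseteq> - spec" using rect_edges_subset[OF ab] out by blast
  have contr: "continuous_on (cbox a b) res" using out by (intro continuous_on_subset[OF continuous_on_res]) auto
  then have "bounded (res ` cbox a b)" by (intro compact_imp_bounded compact_continuous_image) auto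
  then obtain M where M: "\<And>z. z \<in> cbox a b \<Longrightarrow> norm (res z) \<le> M" unfolding bounded_iff by auto
  have cr: "continuous_on (rect_edges a b) res" using contr rect_edges_subset[OF ab] continuous_on_subset by blast
  have cnot: "c \<notin> spec" using c out by blast
  define L where "L = (2 * (Re b - Re a) + norm J * (2 * (Im b - Im a)))"
  have L: "L \<ge> 0" using ab by (simp add: L_def rect_def)
  have "norm (rint a b res - 0) \<le> (L * (cs_bound * M)) * q ^ n" for n
  proof -
    define p where "p k z = cs ((c - z) ^ k) o\<^sub>L (blinfun_power (res c) k o\<^sub>L res c)" for k z
    define r where "r z = cs ((c - z) ^ n) o\<^sub>L blinfun_power (res c) n o\<^sub>L res z" for z
    have eq: "res z = (\<Sum>k<n. p k z) + r z" if "z \<notin> spec" for z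
      using fixed_point_expansion[of "res z" "res c" "cs (c - z) o\<^sub>L res c" n] resolvent_identity[OF that cnot]
      unfolding p_def r_def by (simp add: blinfun_compose_assoc blinfun_power_cs J_res[OF cnot])
    have cp: "continuous_on (rect_edges a b) (p k)" for k
      unfolding p_def by (intro continuous_intros)
    have r: "continuous_on (rect_edges a b) r"
      unfolding r_def by (intro continuous_intros cr)
    have p0: "rint a b (p k) = 0" for k
      unfolding p_def by (rule rint_holomorphic[OF ab, of _ UNIV]) (auto intro!: holomorphic_intros)
    have "rint a b res = rint a b (\<lambda>z. (\<Sum>k<n. p k z) + r z)"
      using eq edges ab by (intro rint_cong) auto
    also have "\<dots> = (\<Sum>k<n. rint a b (p k)) + rint a b r"
      by (simp add: rint_add rint_sum continuous_on_sum cp r ab)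
    finally have "rint a b res = rint a b r" by (simp add: p0)
    moreover have "norm (rint a b r) \<le> L * (cs_bound * M * q ^ n)"
      unfolding L_def
    proof (rule norm_rint_le[OF r ab])
      fix z assume z: "z \<in> rect_edges a b"
      have "norm (r z) \<le> cs_bound * norm (res z) * q ^ n"
        unfolding r_def by (rule norm_remainder_le[OF small[OF z]])
      also have "\<dots> \<le> cs_bound * M * q ^ n"
        using M z rect_edges_subset[OF ab] q cs_bound_ge_1 by (intro mult_right_mono mult_left_mono) auto
      finally show "norm (r z) \<le> cs_bound * M * q ^ n" .
    qed
    ultimately show ?thesis by (simp add: ac_simps)
  qed
  then show ?thesis using q by (intro tendsto_zero_imp_eq[of _ 0]) auto
qed

text \<open>Of the expansion of the resolvent in powers of \<open>1/z\<close>, only the first term contributes.\<close>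

lemma rint_res_large:
  assumes R: "R > cs_bound * norm T"
  shows "rint (Complex (-R) (-R)) (Complex R R) res = cs (2 * of_real pi * \<i>)"
proof -
  let ?a = "Complex (-R) (-R)" and ?b = "Complex R R"
  \<comment> \<open>Two sizes of \<open>R\<close> matter: exceeding \<open>cs_bound * norm T\<close>
    keeps the edges off the spectrum, and exceeding \<open>norm T\<close> makes the ratio
    \<open>q\<close> of the remainder less than 1.\<close>
  have "norm T \<le> cs_bound * norm T" using cs_bound_ge_1 mult_right_mono[of 1 cs_bound "norm T"] by simp
  then have RT: "R > norm T" using R by linarith
  then have R0: "R > 0" using norm_ge_zero[of T] by linarith
  have ab: "rect ?a ?b" using R0 by (simp add: rect_def)
  have big: "cmod z \<ge> R" if "z \<in> rect_edges ?a ?b" for z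
    using that abs_Re_le_cmod[of z] abs_Im_le_cmod[of z] by (auto simp: rect_edges_def)
  then have edges: "rect_edges ?a ?b \<subseteq> - spec" and nz: "\<And>z. z \<in> rect_edges ?a ?b \<Longrightarrow> z \<noteq> 0"
    using not_spec_large R R0 by fastforce+
  have cr: "continuous_on (rect_edges ?a ?b) res" by (rule continuous_on_subset[OF continuous_on_res edges])
  have "compact (rect_edges ?a ?b)" by (rule compact_rect_edges[OF ab])
  then have "bounded (res ` rect_edges ?a ?b)" using cr by (intro compact_imp_bounded compact_continuous_image)
  then obtain M where M: "\<And>z. z \<in> rect_edges ?a ?b \<Longrightarrow> norm (res z) \<le> M" unfolding bounded_iff by auto
  define L where "L = (2 * (R - -R) + norm J * (2 * (R - -R)))"
  have L: "L \<ge> 0" using R0 by (simp add: L_def)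
  define q where "q = norm T / R"
  have q: "0 \<le> q" "q < 1" using RT R0 by (auto simp: q_def)
  have main: "norm (rint ?a ?b res - cs (2 * of_real pi * \<i>)) \<le> (L * (cs_bound * M * q)) * q ^ n" for n
  proof -
    define p where "p k z = cs (inverse z ^ Suc k) o\<^sub>L blinfun_power T k" for k z
    define r where "r z = cs (inverse z ^ Suc n) o\<^sub>L blinfun_power T (Suc n) o\<^sub>L res z" for z
    have eq: "res z = (\<Sum>k<Suc n. p k z) + r z" if "z \<in> rect_edges ?a ?b" for z
    proof -
      have "z \<noteq> 0" "z \<notin> spec" using nz edges that by auto
      \<comment> \<open>Dividing the equation of the resolvent by \<open>z\<close> gives the fixed
        point equation with \<open>u = T / z\<close>.\<close>
      then have "cs (inverse z) o\<^sub>L (cs z - T o\<^sub>L res z) = cs (inverse z)" by (simp add: res_right)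
      then have "res z = cs (inverse z) + (cs (inverse z) o\<^sub>L T o\<^sub>L res z)"
        using \<open>z \<noteq> 0\<close> by (simp add: compose_simps cs_cancel algebra_simps)
      from fixed_point_expansion[OF this, of "Suc n"] show ?thesis
        unfolding p_def r_def blinfun_power_cs[OF J_T] blinfun_compose_assoc blinfun_power_T_cs
        by (simp add: cs_mult cs_left_commute blinfun_compose_assoc del: sum.lessThan_Suc)
    qed
    have cp: "continuous_on (rect_edges ?a ?b) (p k)" for k
      unfolding p_def by (intro continuous_intros) (use nz in auto)
    have r: "continuous_on (rect_edges ?a ?b) r"
      unfolding r_def by (intro continuous_intros cr) (use nz in auto)
    \<comment> \<open>The power of 1/z in \<open>p (Suc k)\<close> is at least the second, which has
      a primitive off the origin; only \<open>p 0\<close> survives.\<close>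
    have p_Suc: "rint ?a ?b (p (Suc k)) = 0" for k
      unfolding p_def
    proof (rule rint_primitive[OF ab, where S = "rect_edges ?a ?b" and W = "\<lambda>z. - inverse (of_nat (Suc k)) * inverse z ^ Suc k"])
      fix z assume "z \<in> rect_edges ?a ?b"
      then have "z \<noteq> 0" by (rule nz)
      have "((\<lambda>z. inverse z ^ Suc k) has_field_derivative
          of_nat (Suc k) * (- (inverse z ^ Suc (Suc 0)) * inverse z ^ k)) (at z within rect_edges ?a ?b)"
        using DERIV_power[OF DERIV_inverse[OF \<open>z \<noteq> 0\<close>], of "Suc k"] by (simp del: of_nat_Suc)
      from DERIV_cmult[OF this, of "- inverse (of_nat (Suc k))"]
      show "((\<lambda>z. - inverse (of_nat (Suc k)) * inverse z ^ Suc k) has_field_derivative inverse z ^ Suc (Suc k))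
         (at z within rect_edges ?a ?b)"
        by (simp del: of_nat_Suc add: mult.assoc[symmetric])
    qed auto
    have "(\<Sum>k<Suc n. rint ?a ?b (p k)) = rint ?a ?b (p 0)"
      by (simp only: sum.lessThan_Suc_shift p_Suc) simp
    moreover have "rint ?a ?b (p 0) = cs (2 * of_real pi * \<i>)"
      using rint_inverse[OF R0, of id_blinfun] by (simp add: p_def[abs_def])
    moreover have "rint ?a ?b res = rint ?a ?b (\<lambda>z. (\<Sum>k<Suc n. p k z) + r z)"
      using eq ab by (intro rint_cong)
    moreover have "rint ?a ?b (\<lambda>z. (\<Sum>k<Suc n. p k z) + r z) = rint ?a ?b (\<lambda>z. \<Sum>k<Suc n. p k z) + rint ?a ?b r"
      by (rule rint_add[OF continuous_on_sum[OF cp] r ab])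
    moreover have "rint ?a ?b (\<lambda>z. \<Sum>k<Suc n. p k z) = (\<Sum>k<Suc n. rint ?a ?b (p k))"
      by (rule rint_sum[OF finite_lessThan cp ab])
    ultimately have "rint ?a ?b res - cs (2 * of_real pi * \<i>) = rint ?a ?b r" by (simp only: add_diff_cancel_left')
    moreover have "norm (rint ?a ?b r) \<le> (2 * (Re ?b - Re ?a) + norm J * (2 * (Im ?b - Im ?a))) * (cs_bound * M * q ^ Suc n)"
    proof (rule norm_rint_le[OF r ab])
      fix z assume z: "z \<in> rect_edges ?a ?b"
      have "inverse (cmod z) * norm T \<le> inverse R * norm T"
        using big[OF z] R0 by (intro mult_right_mono le_imp_inverse_le) auto
      then have "norm (r z) \<le> cs_bound * norm (res z) * q ^ Suc n"
        unfolding r_def by (intro norm_remainder_le) (simp add: norm_inverse q_def divide_inverse mult.commute)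
      also have "\<dots> \<le> cs_bound * M * q ^ Suc n"
        using M[OF z] q cs_bound_ge_1 by (intro mult_right_mono mult_left_mono) auto
      finally show "norm (r z) \<le> cs_bound * M * q ^ Suc n" .
    qed
    ultimately show ?thesis by (simp add: L_def ac_simps)
  qed
  show ?thesis using q main by (intro tendsto_zero_imp_eq) auto
qed

end

section \<open>Grid cells around the spectrum and the cutoff\<close>

lemma closed_UN_cball:
  fixes A :: "'a::euclidean_space set"
  assumes "compact A"
  shows "closed (\<Union>x\<in>A. cball x r)"
proof -
  \<comment> \<open>The union is the Minkowski sum of two compact sets.\<close>
  have "(\<Union>x\<in>A. cball x r) = {x + y |x y. x \<in> A \<and> y \<in> cball 0 r}"
  proof (intro set_eqI iffI)
    fix z assume "z \<in> (\<Union>x\<in>A. cball x r)"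
    then obtain x where "x \<in> A" "dist x z \<le> r" by auto
    then have "z = x + (z - x)" "x \<in> A" "z - x \<in> cball 0 r"
      by (auto simp: dist_norm norm_minus_commute)
    then show "z \<in> {x + y |x y. x \<in> A \<and> y \<in> cball 0 r}" by blast
  next
    fix z assume "z \<in> {x + y |x y. x \<in> A \<and> y \<in> cball 0 r}"
    then show "z \<in> (\<Union>x\<in>A. cball x r)" by (auto simp: dist_norm intro!: bexI)
  qed
  then show ?thesis
    using compact_sums[OF assms compact_cball, of 0 r] compact_imp_closed by simp
qed

lemma grid_cell_dist_le:
  assumes "z \<in> cbox (grid_point c d i j) (grid_point c d (Suc i) (Suc j))"
    "w \<in> cbox (grid_point c d i j) (grid_point c d (Suc i) (Suc j))"
  shows "cmod (z - w) \<le> 2 * d"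
proof -
  have "\<bar>Re (z - w)\<bar> \<le> d" "\<bar>Im (z - w)\<bar> \<le> d"
    using assms by (auto simp: in_cbox_complex_iff algebra_simps)
  then show ?thesis using cmod_le[of "z - w"] by linarith
qed

context complex_operator
begin

text \<open>Used twice: for the cut-off resolvent, where the cells missing \<open>N\<close>
  contribute nothing by Cauchy's theorem, and for a function vanishing off \<open>N\<close>.\<close>

lemma sum_rint_cells:
  assumes d: "d \<ge> 0" and g: "continuous_on UNIV g"
    and zero: "\<And>i j. i < m \<Longrightarrow> j < m \<Longrightarrow>
      cbox (grid_point c d i j) (grid_point c d (Suc i) (Suc j)) \<inter> N = {} \<Longrightarrow>
      rint (grid_point c d i j) (grid_point c d (Suc i) (Suc j)) g = 0"
  shows "(\<Sum>(i, j)\<in>{(i, j). i < m \<and> j < m \<and>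
        cbox (grid_point c d i j) (grid_point c d (Suc i) (Suc j)) \<inter> N \<noteq> {}}.
      rint (grid_point c d i j) (grid_point c d (Suc i) (Suc j)) g) = rint c (grid_point c d m m) g"
    (is "sum ?F ?S = _")
proof -
  have "sum ?F ?S = sum ?F ({..<m} \<times> {..<m})"
    using zero by (intro sum.mono_neutral_left) auto
  also have "\<dots> = (\<Sum>i<m. \<Sum>j<m. rint (grid_point c d i j) (grid_point c d (Suc i) (Suc j)) g)"
    by (simp add: sum.cartesian_product)
  also have "\<dots> = rint c (grid_point c d m m) g"
    by (rule sum_rint_grid[OF d continuous_on_subset[OF g subset_UNIV]])
  finally show ?thesis .
qed

text \<open>
  The resolvent is cut off to zero near the spectrum by \<open>\<phi>\<close> (giving \<open>R = \<phi> res\<close>), so that all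
  integrals below have continuous integrands on the whole plane, and the rectangles in \<open>S\<close> are the
  cells of a fine grid that meet a neighbourhood \<open>N\<close> of the spectrum outside of which \<open>\<phi> = 1\<close>.
  Integrating over all cells of \<open>S\<close> replaces integrating over a contour around the spectrum: the
  sum of the integrals over all cells telescopes to the outer boundary. For the last claim this is
  applied to \<open>(\<phi> - 1) k\<close>, which vanishes off \<open>N\<close>.
\<close>

lemma cutoff_resolvent:
  assumes U: "open U" "spec \<subseteq> U"
  obtains S :: "(nat \<times> nat) set" and lo hi \<phi> R where
    "finite S" "\<And>q. q \<in> S \<Longrightarrow> rect (lo q) (hi q)" "\<And>q. q \<in> S \<Longrightarrow> cbox (lo q) (hi q) \<subseteq> U"
    "continuous_on UNIV R" "continuous_on UNIV \<phi>"
    "\<And>z. (cs z - T) o\<^sub>L R z = \<phi> z *\<^sub>R id_blinfun" "\<And>z. R z o\<^sub>L (cs z - T) = \<phi> z *\<^sub>R id_blinfun"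
    "(\<Sum>q\<in>S. rint (lo q) (hi q) R) = cs (2 * of_real pi * \<i>)"
    "\<And>k. continuous_on U k \<Longrightarrow> (\<And>q. q \<in> S \<Longrightarrow> rint (lo q) (hi q) k = 0) \<Longrightarrow>
       (\<Sum>q\<in>S. rint (lo q) (hi q) (\<lambda>z. \<phi> z *\<^sub>R k z)) = 0"
proof -
  obtain e where e: "e > 0" "(\<Union>x\<in>spec. cball x e) \<subseteq> U"
    using compact_subset_open_imp_cball_epsilon_subset[OF compact_spec U] by blast
  \<comment> \<open>The radii are staggered: \<open>\<phi>\<close> vanishes up to
    \<open>e / 3\<close> and equals 1 from \<open>2 * e / 3\<close> on. The gap up to
    \<open>e\<close> leaves room inside \<open>U\<close> for a cell of diameter below
    \<open>e / 3\<close> that meets \<open>N\<close>.\<close>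
  define N where "N = (\<Union>x\<in>spec. ball x (2 * e / 3))"
  define C where "C = (\<Union>x\<in>spec. cball x (2 * e / 3))"
  define S0 where "S0 = (\<Union>x\<in>spec. cball x (e / 3))"
  define I0 where "I0 = (\<Union>x\<in>spec. ball x (e / 3))"
  have sub: "spec \<subseteq> I0" "I0 \<subseteq> S0" "S0 \<subseteq> N" "N \<subseteq> C"
    using e(1) unfolding N_def C_def S0_def I0_def by force+
  have "(\<Union>x\<in>spec. cball x (2 * e / 3)) \<subseteq> (\<Union>x\<in>spec. cball x e)"
    using e(1) by (intro UN_mono subset_cball) auto
  then have CU: "C \<subseteq> U" using e(2) unfolding C_def by blast
  have opens: "open N" "open I0" "closed C" "closed S0"
    unfolding N_def C_def S0_def I0_def using closed_UN_cball[OF compact_spec] by auto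
  obtain \<phi> :: "complex \<Rightarrow> real" where \<phi>: "continuous_on UNIV \<phi>" "\<And>z. z \<in> S0 \<Longrightarrow> \<phi> z = 0" "\<And>z. z \<in> - N \<Longrightarrow> \<phi> z = 1"
    using Urysohn[of S0 "- N" 0 1] opens sub by (metis closed_Compl Diff_eq Diff_eq_empty_iff)
  define R where "R z = \<phi> z *\<^sub>R res z" for z
  have R0: "R z = 0" "\<phi> z = 0" if "z \<in> spec" for z
    using that sub \<phi>(2) by (auto simp: R_def)
  have contR: "continuous_on UNIV R"
  proof -
    have "continuous_on (- spec) R"
      unfolding R_def by (intro continuous_intros continuous_on_res continuous_on_subset[OF \<phi>(1)]) auto
    moreover have "continuous_on I0 R"
      using sub \<phi>(2) by (intro continuous_on_eq[OF continuous_on_const[of _ 0]]) (auto simp: R_def)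
    ultimately have "continuous_on (- spec \<union> I0) R"
      using open_resolvent opens by (intro continuous_on_open_Un) auto
    moreover have "- spec \<union> I0 = UNIV" using sub by blast
    ultimately show ?thesis by simp
  qed
  \<comment> \<open>Large enough for \<open>rint_res_large\<close>, and with a margin above
    \<open>2 * e / 3\<close>, so that the boundary of the square misses \<open>N\<close>.\<close>
  define b where "b = cs_bound * norm T + e + 1"
  have csT: "cs_bound * norm T \<ge> 0" using cs_bound_ge_1 by simp
  have b: "b > 0" "b > cs_bound * norm T" using csT e(1) by (auto simp: b_def)
  let ?a = "Complex (-b) (-b)" and ?b = "Complex b b"
  have "cmod z < b" if "z \<in> N" for z
  proof -
    have "\<exists>x\<in>spec. dist x z < 2 * e / 3" using that by (simp add: N_def)
    then obtain x where x: "x \<in> spec" "dist x z < 2 * e / 3" by blast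
    then have "cmod x \<le> cs_bound * norm T" using spec_bounded by auto
    moreover have "cmod z \<le> cmod x + dist x z" by (metis dist_norm norm_triangle_sub norm_minus_commute)
    ultimately show ?thesis using x(2) e(1) by (simp add: b_def)
  qed
  moreover have "cmod z \<ge> b" if "z \<in> rect_edges ?a ?b" for z
    using that abs_Re_le_cmod[of z] abs_Im_le_cmod[of z] by (auto simp: rect_edges_def)
  ultimately have edgesN: "rect_edges ?a ?b \<inter> N = {}" by force
  have ab: "rect ?a ?b" using b by (simp add: rect_def)
  have "compact (cbox ?a ?b - N)" using opens(1) by (intro compact_diff) auto
  moreover have "continuous_on (cbox ?a ?b - N) res"
    using sub by (intro continuous_on_subset[OF continuous_on_res]) auto
  ultimately have "bounded (res ` (cbox ?a ?b - N))"
    by (intro compact_imp_bounded compact_continuous_image)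
  then obtain M where M: "M > 0" "\<And>z. z \<in> cbox ?a ?b - N \<Longrightarrow> norm (res z) \<le> M"
    unfolding bounded_pos by auto
  \<comment> \<open>With mesh \<open>d = 2 * b / m\<close> a single inequality yields both smallness
    conditions: \<open>2 * d < e / 3\<close> keeps the chosen cells in \<open>U\<close>, and
    \<open>2 * d * M < 1\<close> is the ratio required by \<open>rint_res_outside\<close>.\<close>
  obtain m :: nat where m: "real m > 2 * b * (6 / e + 2 * M)" using reals_Archimedean2 by blast
  have m0: "real m > 0"
    by (rule le_less_trans[OF _ m]) (use b M e in auto)
  define d where "d = 2 * b / real m"
  have d: "d > 0" using b m0 by (simp add: d_def)
  have "d * (6 / e + 2 * M) < 1" using m m0 by (simp add: d_def field_simps)
  then have "d * 6 / e + 2 * d * M < 1" by (simp add: algebra_simps)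
  moreover have "d * 6 / e > 0" "2 * d * M > 0" using d e M by auto
  ultimately have "d * 6 / e < 1" and dM: "2 * d * M < 1" by linarith+
  then have de: "2 * d < e / 3" using e(1) by (simp add: field_simps)
  let ?lo = "\<lambda>i j. grid_point ?a d i j" and ?hi = "\<lambda>i j. grid_point ?a d (Suc i) (Suc j)"
  have corner: "grid_point ?a d m m = ?b" using m0 by (simp add: grid_point_def d_def)
  define S where "S = {(i, j). i < m \<and> j < m \<and> cbox (?lo i j) (?hi i j) \<inter> N \<noteq> {}}"
  note cells = sum_rint_cells[where c = ?a and d = d and m = m and N = N, folded S_def, unfolded corner, OF less_imp_le[OF d]]
  have lo: "?lo i j \<in> cbox (?lo i j) (?hi i j)" for i j using d by (auto simp: in_cbox_complex_iff algebra_simps)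
  have rect: "rect (?lo i j) (?hi i j)" for i j using d by (intro rect_grid_cell) auto
  show ?thesis
  proof (rule that[of S "\<lambda>(i, j). ?lo i j" "\<lambda>(i, j). ?hi i j" R \<phi>])
    show "finite S" by (rule finite_subset[of _ "{..<m} \<times> {..<m}"]) (auto simp: S_def)
    show "rect (case q of (i, j) \<Rightarrow> ?lo i j) (case q of (i, j) \<Rightarrow> ?hi i j)" for q
      using rect by (cases q) simp
    show "cbox (case q of (i, j) \<Rightarrow> ?lo i j) (case q of (i, j) \<Rightarrow> ?hi i j) \<subseteq> U" if q: "q \<in> S" for q
    proof -
      obtain i j where ij: "q = (i, j)" by (cases q)
      obtain w x where w: "w \<in> cbox (?lo i j) (?hi i j)" "x \<in> spec" "dist x w < 2 * e / 3"
        using q unfolding S_def ij N_def by auto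
      have "dist x z \<le> e" if "z \<in> cbox (?lo i j) (?hi i j)" for z
        using grid_cell_dist_le[OF w(1) that] w(3) de dist_triangle[of x z w] by (simp add: dist_norm)
      then have "cbox (?lo i j) (?hi i j) \<subseteq> cball x e" by (simp only: subset_eq mem_cball) blast
      then show ?thesis using e(2) w(2) unfolding ij split by blast
    qed
    show "continuous_on UNIV R" "continuous_on UNIV \<phi>" by fact+
    show "(cs z - T) o\<^sub>L R z = \<phi> z *\<^sub>R id_blinfun" "R z o\<^sub>L (cs z - T) = \<phi> z *\<^sub>R id_blinfun" for z
      using R0[of z] res_left[of z] res_right[of z]
      by (cases "z \<in> spec"; simp add: R_def compose_simps(8,9))+
    have "(\<Sum>(i, j)\<in>S. rint (?lo i j) (?hi i j) R) = rint ?a ?b R"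
    proof (rule cells[OF contR])
      fix i j assume ij: "i < m" "j < m" and disj: "cbox (?lo i j) (?hi i j) \<inter> N = {}"
      have sub': "cbox (?lo i j) (?hi i j) \<subseteq> cbox ?a ?b - N"
        using grid_cell_subset[OF less_imp_le[OF d] ij, of ?a] disj unfolding corner by blast
      have "rint (?lo i j) (?hi i j) R = rint (?lo i j) (?hi i j) res"
        using sub' rect_edges_subset[OF rect[of i j]] \<phi>(3) by (intro rint_cong rect) (auto simp: R_def)
      also have "\<dots> = 0"
      proof (rule rint_res_outside[OF rect])
        show "cbox (?lo i j) (?hi i j) \<inter> spec = {}" using disj sub by blast
        show "?lo i j \<in> cbox (?lo i j) (?hi i j)" by (rule lo)
        show "0 \<le> 2 * d * M" "2 * d * M < 1" using d M dM by auto
        fix z assume "z \<in> rect_edges (?lo i j) (?hi i j)"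
        then have "z \<in> cbox (?lo i j) (?hi i j)" using rect_edges_subset[OF rect] by blast
        then show "cmod (?lo i j - z) * norm (res (?lo i j)) \<le> 2 * d * M"
          using grid_cell_dist_le[OF lo] M(2)[of "?lo i j"] sub' lo[of i j] d
          by (intro mult_mono) auto
      qed
      finally show "rint (?lo i j) (?hi i j) R = 0" .
    qed
    also have "rint ?a ?b R = rint ?a ?b res"
    proof (rule rint_cong[OF _ ab])
      fix z assume "z \<in> rect_edges ?a ?b"
      then have "\<phi> z = 1" using edgesN \<phi>(3) by blast
      then show "R z = res z" by (simp add: R_def)
    qed
    also have "\<dots> = cs (2 * of_real pi * \<i>)" by (rule rint_res_large[OF b(2)])
    finally show "(\<Sum>q\<in>S. rint (case q of (i, j) \<Rightarrow> ?lo i j) (case q of (i, j) \<Rightarrow> ?hi i j) R)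
        = cs (2 * of_real pi * \<i>)" by (simp add: split_def)
    fix k assume k: "continuous_on U k"
      and kz: "\<And>q. q \<in> S \<Longrightarrow> rint (case q of (i, j) \<Rightarrow> ?lo i j) (case q of (i, j) \<Rightarrow> ?hi i j) k = 0"
    \<comment> \<open>Only on \<open>U\<close> is \<open>k\<close> known to be continuous. Extension
      by zero is continuous because the closed set \<open>C\<close> separates \<open>N\<close>, off
      which the product vanishes, from the complement of \<open>U\<close>.\<close>
    define g where "g z = (if z \<in> U then (\<phi> z - 1) *\<^sub>R k z else 0)" for z
    have gN: "g z = 0" if "z \<notin> N" for z using \<phi>(3) that by (simp add: g_def)
    have contg: "continuous_on UNIV g"
    proof -
      have "continuous_on U g"
        by (rule continuous_on_eq[of _ "\<lambda>z. (\<phi> z - 1) *\<^sub>R k z"])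
           (auto intro!: continuous_intros k continuous_on_subset[OF \<phi>(1)] simp: g_def)
      moreover have "continuous_on (- C) g"
      proof (rule continuous_on_eq[OF continuous_on_const[of _ 0]])
        fix z assume "z \<in> - C"
        then have "z \<notin> N" using sub(4) by blast
        then show "0 = g z" by (simp add: gN)
      qed
      ultimately have "continuous_on (U \<union> - C) g"
        using U opens by (intro continuous_on_open_Un) auto
      moreover have "U \<union> - C = UNIV" using CU by blast
      ultimately show ?thesis by simp
    qed
    have "(\<Sum>(i, j)\<in>S. rint (?lo i j) (?hi i j) g) = rint ?a ?b g"
    proof (rule cells[OF contg])
      fix i j assume disj: "cbox (?lo i j) (?hi i j) \<inter> N = {}"
      have "rint (?lo i j) (?hi i j) g = rint (?lo i j) (?hi i j) (\<lambda>z. 0)"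
        using disj rect_edges_subset[OF rect[of i j]] by (intro rint_cong rect gN) blast
      then show "rint (?lo i j) (?hi i j) g = 0" by simp
    qed
    also have "rint ?a ?b g = rint ?a ?b (\<lambda>z. 0)"
      using edgesN by (intro rint_cong ab gN) blast
    finally have sum0: "(\<Sum>(i, j)\<in>S. rint (?lo i j) (?hi i j) g) = 0" by simp
    have "rint (?lo i j) (?hi i j) (\<lambda>z. \<phi> z *\<^sub>R k z) = rint (?lo i j) (?hi i j) g" if "(i, j) \<in> S" for i j
    proof -
      have inU: "rect_edges (?lo i j) (?hi i j) \<subseteq> U"
        using \<open>\<And>q. q \<in> S \<Longrightarrow> cbox (case q of (i, j) \<Rightarrow> ?lo i j) (case q of (i, j) \<Rightarrow> ?hi i j) \<subseteq> U\<close>[OF that]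
          rect_edges_subset[OF rect[of i j]] by auto
      have "rint (?lo i j) (?hi i j) (\<lambda>z. \<phi> z *\<^sub>R k z) = rint (?lo i j) (?hi i j) (\<lambda>z. g z + k z)"
        using inU by (intro rint_cong rect) (auto simp: g_def algebra_simps)
      also have "\<dots> = rint (?lo i j) (?hi i j) g + rint (?lo i j) (?hi i j) k"
        by (intro rint_add rect continuous_on_subset[OF contg] continuous_on_subset[OF k] inU) auto
      finally show ?thesis using kz[OF that] by simp
    qed
    then have "(\<Sum>(i, j)\<in>S. rint (?lo i j) (?hi i j) (\<lambda>z. \<phi> z *\<^sub>R k z)) = (\<Sum>(i, j)\<in>S. rint (?lo i j) (?hi i j) g)"
      by (intro sum.cong) auto
    then show "(\<Sum>q\<in>S. rint (case q of (i, j) \<Rightarrow> ?lo i j) (case q of (i, j) \<Rightarrow> ?hi i j) (\<lambda>z. \<phi> z *\<^sub>R k z)) = 0"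
      using sum0 by (simp add: split_def)
  qed
qed

end

subsection \<open>The scalar functional calculus\<close>

context complex_structure
begin

text \<open>A substitute for holomorphy of operator valued functions; by Fubini it is inherited by
  integrals depending holomorphically on a parameter, and it passes to products with scalar functions.\<close>

definition cauchy_on :: "complex set \<Rightarrow> (complex \<Rightarrow> 'w \<Rightarrow>\<^sub>L 'w) \<Rightarrow> bool" where
  "cauchy_on U h \<longleftrightarrow> continuous_on U h \<and>
     (\<forall>g a b. g holomorphic_on U \<longrightarrow> rect a b \<longrightarrow> cbox a b \<subseteq> U \<longrightarrow> rint a b (\<lambda>z. cs (g z) o\<^sub>L h z) = 0)"

lemma cauchy_onI:
  assumes "continuous_on U h"
    "\<And>g a b. g holomorphic_on U \<Longrightarrow> rect a b \<Longrightarrow> cbox a b \<subseteq> U \<Longrightarrow> continuous_on (rect_edges a b) g \<Longrightarrow> rint a b (\<lambda>z. cs (g z) o\<^sub>L h z) = 0"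
  shows "cauchy_on U h"
  unfolding cauchy_on_def
proof (intro conjI allI impI assms)
  fix g a b assume g: "g holomorphic_on U" "rect a b" "cbox a b \<subseteq> U"
  then have "rect_edges a b \<subseteq> U" using rect_edges_subset by blast
  then show "continuous_on (rect_edges a b) g"
    by (rule continuous_on_subset[OF holomorphic_on_imp_continuous_on[OF g(1)]])
qed

lemma cauchy_on_rint:
  "cauchy_on U h \<Longrightarrow> g holomorphic_on U \<Longrightarrow> rect a b \<Longrightarrow> cbox a b \<subseteq> U \<Longrightarrow> rint a b (\<lambda>z. cs (g z) o\<^sub>L h z) = 0"
  by (auto simp: cauchy_on_def)

lemma cauchy_on_rint_0: "cauchy_on U h \<Longrightarrow> rect a b \<Longrightarrow> cbox a b \<subseteq> U \<Longrightarrow> rint a b h = 0"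
  using cauchy_on_rint[of U h "\<lambda>z. 1"] by (simp add: holomorphic_on_const)

lemma cauchy_on_holomorphic:
  assumes "f holomorphic_on U"
  shows "cauchy_on U (\<lambda>z. cs (f z) o\<^sub>L A)"
proof (rule cauchy_onI)
  show "continuous_on U (\<lambda>z. cs (f z) o\<^sub>L A)"
    using assms by (intro continuous_intros holomorphic_on_imp_continuous_on)
  fix g a b assume "g holomorphic_on U" "rect a b" "cbox a b \<subseteq> U"
  then show "rint a b (\<lambda>z. cs (g z) o\<^sub>L (cs (f z) o\<^sub>L A)) = 0"
    using rint_holomorphic[of a b "\<lambda>z. g z * f z" U A] assms
    by (simp add: cs_mult blinfun_compose_assoc holomorphic_on_mult)
qed

lemma cauchy_on_const: "cauchy_on U (\<lambda>z. A)"
  using cauchy_on_holomorphic[of "\<lambda>z. 1" U A] by (simp add: holomorphic_on_const)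

lemma cauchy_on_add:
  assumes "cauchy_on U h" "cauchy_on U k"
  shows "cauchy_on U (\<lambda>z. h z + k z)"
proof (rule cauchy_onI)
  have c: "continuous_on U h" "continuous_on U k" using assms by (auto simp: cauchy_on_def)
  then show "continuous_on U (\<lambda>z. h z + k z)" by (rule continuous_on_add)
  fix g a b assume g: "g holomorphic_on U" "rect a b" "cbox a b \<subseteq> U" "continuous_on (rect_edges a b) g"
  then have "rect_edges a b \<subseteq> U" using rect_edges_subset by blast
  note c' = c[THEN continuous_on_subset, OF this]
  show "rint a b (\<lambda>z. cs (g z) o\<^sub>L (h z + k z)) = 0"
    using assms[THEN cauchy_on_rint, OF g(1-3)]
    by (simp add: compose_simps rint_add continuous_intros c' g)
qed

lemma cauchy_on_sum:
  "finite K \<Longrightarrow> (\<And>k. k \<in> K \<Longrightarrow> cauchy_on U (h k)) \<Longrightarrow> cauchy_on U (\<lambda>z. \<Sum>k\<in>K. h k z)"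
  by (induction K rule: finite_induct) (simp_all add: cauchy_on_const cauchy_on_add)

lemma cauchy_on_compose_left:
  assumes "cauchy_on U h" "J o\<^sub>L B = B o\<^sub>L J"
  shows "cauchy_on U (\<lambda>z. B o\<^sub>L h z)"
proof (rule cauchy_onI)
  show "continuous_on U (\<lambda>z. B o\<^sub>L h z)" using assms by (auto simp: cauchy_on_def intro!: continuous_intros)
  fix g a b assume g: "g holomorphic_on U" "rect a b" "cbox a b \<subseteq> U" "continuous_on (rect_edges a b) g"
  have h: "continuous_on (rect_edges a b) h"
    using assms(1) rect_edges_subset[OF g(2)] g(3) by (auto simp: cauchy_on_def intro: continuous_on_subset)
  have "cs (g z) o\<^sub>L (B o\<^sub>L h z) = B o\<^sub>L (cs (g z) o\<^sub>L h z)" for z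
    using cs_commute[OF assms(2)] by (metis blinfun_compose_assoc)
  then show "rint a b (\<lambda>z. cs (g z) o\<^sub>L (B o\<^sub>L h z)) = 0"
    using cauchy_on_rint[OF assms(1) g(1-3)] by (simp add: rint_compose_left assms(2) g h continuous_intros)
qed

lemma cauchy_on_compose_right:
  assumes "cauchy_on U h"
  shows "cauchy_on U (\<lambda>z. h z o\<^sub>L B)"
proof (rule cauchy_onI)
  show "continuous_on U (\<lambda>z. h z o\<^sub>L B)" using assms by (auto simp: cauchy_on_def intro!: continuous_intros)
  fix g a b assume g: "g holomorphic_on U" "rect a b" "cbox a b \<subseteq> U" "continuous_on (rect_edges a b) g"
  have h: "continuous_on (rect_edges a b) h"
    using assms(1) rect_edges_subset[OF g(2)] g(3) by (auto simp: cauchy_on_def intro: continuous_on_subset)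
  show "rint a b (\<lambda>z. cs (g z) o\<^sub>L (h z o\<^sub>L B)) = 0"
    using cauchy_on_rint[OF assms(1) g(1-3)]
    by (simp add: rint_compose_right g h continuous_intros blinfun_compose_assoc[symmetric])
qed

text \<open>This is the purpose of the test function in \<open>cauchy_on\<close>: the product
  \<open>g * f\<close> is again a test function.\<close>

lemma cauchy_on_mult:
  assumes "cauchy_on U h" "f holomorphic_on U"
  shows "cauchy_on U (\<lambda>z. cs (f z) o\<^sub>L h z)"
proof (rule cauchy_onI)
  show "continuous_on U (\<lambda>z. cs (f z) o\<^sub>L h z)"
    using assms by (auto simp: cauchy_on_def intro!: continuous_intros holomorphic_on_imp_continuous_on)
  fix g a b assume g: "g holomorphic_on U" "rect a b" "cbox a b \<subseteq> U"
  then show "rint a b (\<lambda>z. cs (g z) o\<^sub>L (cs (f z) o\<^sub>L h z)) = 0"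
    using cauchy_on_rint[OF assms(1) holomorphic_on_mult[OF g(1) assms(2)] g(2,3)]
    by (simp add: cs_mult blinfun_compose_assoc)
qed

text \<open>Since \<open>S\<close> is antilinear, moving it out of the integral replaces
  \<open>g\<close> by \<open>cnj \<circ> g \<circ> cnj\<close>, which is holomorphic and thus an
  admissible test function on the reflected rectangle.\<close>

lemma cauchy_on_conjugate:
  assumes h: "cauchy_on U h" and U: "open U" "\<And>z. z \<in> U \<Longrightarrow> cnj z \<in> U"
    and S: "S o\<^sub>L J = - (J o\<^sub>L S)"
  shows "cauchy_on U (\<lambda>z. S o\<^sub>L h (cnj z) o\<^sub>L S)"
proof (rule cauchy_onI)
  have ch: "continuous_on U h" using h by (simp add: cauchy_on_def)
  show "continuous_on U (\<lambda>z. S o\<^sub>L h (cnj z) o\<^sub>L S)"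
    by (intro continuous_intros continuous_on_compose2[OF ch]) (use U in auto)
  fix g a b assume g: "g holomorphic_on U" "rect a b" "cbox a b \<subseteq> U"
  let ?a = "Complex (Re a) (- Im b)" and ?b = "Complex (Re b) (- Im a)"
  have r: "rect ?a ?b" using g(2) by (simp add: rect_def)
  have sub: "cbox ?a ?b \<subseteq> U"
  proof
    fix z assume "z \<in> cbox ?a ?b"
    then have "cnj z \<in> U" using g(3) by (intro subsetD[OF g(3)]) (auto simp: in_cbox_complex_iff)
    then show "z \<in> U" using U(2)[of "cnj z"] by simp
  qed
  have im: "cnj ` U = U"
  proof (intro equalityI subsetI)
    fix z assume "z \<in> U"
    then show "z \<in> cnj ` U" using U(2)[of z] by (intro image_eqI[of _ _ "cnj z"]) auto
  qed (use U(2) in auto)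
  have hol: "(cnj \<circ> g \<circ> cnj) holomorphic_on U"
    by (rule holomorphic_on_compose_cnj_cnj) (use g(1) U(1) im in auto)
  have csS: "cs w o\<^sub>L S = S o\<^sub>L cs (cnj w)" for w
    using S by (simp add: cs_def compose_simps)
  have "rint a b (\<lambda>z. cs (g z) o\<^sub>L (S o\<^sub>L h (cnj z) o\<^sub>L S))
      = rint a b (\<lambda>z. S o\<^sub>L (cs ((cnj \<circ> g \<circ> cnj) (cnj z)) o\<^sub>L h (cnj z)) o\<^sub>L S)"
    by (simp add: blinfun_compose_assoc[symmetric] csS)
  also have "\<dots> = - (S o\<^sub>L rint ?a ?b (\<lambda>z. cs ((cnj \<circ> g \<circ> cnj) z) o\<^sub>L h z) o\<^sub>L S)"
    by (rule rint_conjugate[OF S g(2), of "\<lambda>z. cs ((cnj \<circ> g \<circ> cnj) z) o\<^sub>L h z"])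
       (intro continuous_intros continuous_on_subset[OF ch sub]
          continuous_on_subset[OF holomorphic_on_imp_continuous_on[OF hol] sub])
  also have "rint ?a ?b (\<lambda>z. cs ((cnj \<circ> g \<circ> cnj) z) o\<^sub>L h z) = 0"
    by (rule cauchy_on_rint[OF h hol r sub])
  finally show "rint a b (\<lambda>z. cs (g z) o\<^sub>L (S o\<^sub>L h (cnj z) o\<^sub>L S)) = 0" by simp
qed

end

context complex_operator
begin

text \<open>\<open>A\<close> is the value at \<open>T\<close> of \<open>f\<close>: the remainder of \<open>f\<close> on division by \<open>z - T\<close>.\<close>

definition calc :: "complex set \<Rightarrow> (complex \<Rightarrow> complex) \<Rightarrow> ('w \<Rightarrow>\<^sub>L 'w) \<Rightarrow> bool" where
  "calc U f A \<longleftrightarrow> (\<exists>h. cauchy_on U h \<and> (\<forall>z\<in>U. cs (f z) - A = (cs z - T) o\<^sub>L h z))"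

lemma calc_cong: "(\<And>z. z \<in> U \<Longrightarrow> f z = g z) \<Longrightarrow> calc U f A \<longleftrightarrow> calc U g A"
  by (simp add: calc_def)

lemma calc_const: "calc U (\<lambda>z. c) (cs c)"
  unfolding calc_def by (intro exI[of _ "\<lambda>z. 0"]) (simp add: cauchy_on_const)

lemma calc_id: "calc U (\<lambda>z. z) T"
  unfolding calc_def by (intro exI[of _ "\<lambda>z. id_blinfun"]) (simp add: cauchy_on_const)

lemma calc_add:
  assumes "calc U f A" "calc U g B"
  shows "calc U (\<lambda>z. f z + g z) (A + B)"
proof -
  obtain h k where h: "cauchy_on U h" "\<And>z. z \<in> U \<Longrightarrow> cs (f z) - A = (cs z - T) o\<^sub>L h z"
    and k: "cauchy_on U k" "\<And>z. z \<in> U \<Longrightarrow> cs (g z) - B = (cs z - T) o\<^sub>L k z"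
    using assms unfolding calc_def by auto
  have "cs (f z + g z) - (A + B) = (cs z - T) o\<^sub>L (h z + k z)" if "z \<in> U" for z
    unfolding compose_simps(3) h(2)[OF that, symmetric] k(2)[OF that, symmetric] by (simp add: cs_add)
  then show ?thesis unfolding calc_def using cauchy_on_add[OF h(1) k(1)] by blast
qed

text \<open>By fg - AB = f(g - B) + (f - A)B the new quotient is \<open>f k + h B\<close>.
  Holomorphy of \<open>f\<close> makes its first summand satisfy Cauchy's theorem.\<close>

lemma calc_mult:
  assumes "calc U f A" "calc U g B" "f holomorphic_on U"
  shows "calc U (\<lambda>z. f z * g z) (A o\<^sub>L B)"
proof -
  obtain h k where h: "cauchy_on U h" "\<And>z. z \<in> U \<Longrightarrow> cs (f z) - A = (cs z - T) o\<^sub>L h z"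
    and k: "cauchy_on U k" "\<And>z. z \<in> U \<Longrightarrow> cs (g z) - B = (cs z - T) o\<^sub>L k z"
    using assms unfolding calc_def by auto
  have "cs (f z * g z) - (A o\<^sub>L B) = (cs z - T) o\<^sub>L ((cs (f z) o\<^sub>L k z) + (h z o\<^sub>L B))" if "z \<in> U" for z
  proof -
    have "(cs z - T) o\<^sub>L (cs (f z) o\<^sub>L k z) = cs (f z) o\<^sub>L ((cs z - T) o\<^sub>L k z)"
      by (simp add: compose_simps cs_left_commute T_cs_left)
    then show ?thesis
      unfolding compose_simps(3) blinfun_compose_assoc[symmetric, of _ _ B]
        h(2)[OF that, symmetric] k(2)[OF that, symmetric]
      by (simp add: compose_simps cs_mult k(2)[OF that, symmetric])
  qed
  then show ?thesis
    unfolding calc_def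
    using cauchy_on_add[OF cauchy_on_mult[OF k(1) assms(3)] cauchy_on_compose_right[OF h(1)]] by blast
qed

lemma calc_scale: "calc U f A \<Longrightarrow> calc U (\<lambda>z. c * f z) (cs c o\<^sub>L A)"
  by (rule calc_mult[OF calc_const]) (auto simp: holomorphic_on_const)

lemma calc_power: "calc U (\<lambda>z. z ^ k) (blinfun_power T k)"
proof (induction k)
  case 0
  then show ?case using calc_const[of U 1] by simp
next
  case (Suc k)
  then show ?case using calc_mult[OF calc_id Suc] by (simp add: holomorphic_on_ident)
qed

text \<open>Multiplying -A = (z - T) h(z) by \<open>R\<close> from the left gives
  \<open>R z o\<^sub>L (- A) = \<phi> z *\<^sub>R h z\<close>. Summed over the cells, the left side
  integrates to -A times 2 pi \<i>, the right side to zero, because \<open>h\<close> satisfies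
  Cauchy's theorem on every cell.\<close>

lemma calc_zero_unique:
  assumes U: "open U" "spec \<subseteq> U" and A: "calc U (\<lambda>z. 0) A"
  shows "A = 0"
proof -
  obtain h where h: "cauchy_on U h" "\<And>z. z \<in> U \<Longrightarrow> - A = (cs z - T) o\<^sub>L h z"
    using A unfolding calc_def by auto
  from U show ?thesis
  proof (rule cutoff_resolvent)
    fix S :: "(nat \<times> nat) set" and lo hi \<phi> R
    assume S: "finite S" "\<And>q. q \<in> S \<Longrightarrow> rect (lo q) (hi q)" "\<And>q. q \<in> S \<Longrightarrow> cbox (lo q) (hi q) \<subseteq> U"
      and R: "continuous_on UNIV R" "\<And>z. R z o\<^sub>L (cs z - T) = \<phi> z *\<^sub>R id_blinfun"
      and sumR: "(\<Sum>q\<in>S. rint (lo q) (hi q) R) = cs (2 * of_real pi * \<i>)"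
      and sum0: "\<And>k. continuous_on U k \<Longrightarrow> (\<And>q. q \<in> S \<Longrightarrow> rint (lo q) (hi q) k = 0) \<Longrightarrow>
       (\<Sum>q\<in>S. rint (lo q) (hi q) (\<lambda>z. \<phi> z *\<^sub>R k z)) = 0"
    have "rint (lo q) (hi q) R o\<^sub>L (- A) = rint (lo q) (hi q) (\<lambda>z. \<phi> z *\<^sub>R h z)" if "q \<in> S" for q
    proof -
      have "R z o\<^sub>L (- A) = \<phi> z *\<^sub>R h z" if "z \<in> U" for z
        by (simp only: h(2)[OF that] blinfun_compose_assoc[symmetric] R(2)) (simp add: compose_simps)
      then have "rint (lo q) (hi q) (\<lambda>z. R z o\<^sub>L (- A)) = rint (lo q) (hi q) (\<lambda>z. \<phi> z *\<^sub>R h z)"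
        using S(2,3)[OF that] rect_edges_subset by (intro rint_cong) blast+
      then show ?thesis
        using rint_compose_right[OF continuous_on_subset[OF R(1) subset_UNIV] S(2)[OF that], of "- A"] by simp
    qed
    then have "cs (2 * of_real pi * \<i>) o\<^sub>L (- A) = (\<Sum>q\<in>S. rint (lo q) (hi q) (\<lambda>z. \<phi> z *\<^sub>R h z))"
      unfolding sumR[symmetric] by (simp add: compose_sum_left)
    also have "\<dots> = 0"
    proof (rule sum0)
      show "continuous_on U h" using h(1) by (simp add: cauchy_on_def)
      show "rint (lo q) (hi q) h = 0" if "q \<in> S" for q
        by (rule cauchy_on_rint_0[OF h(1) S(2,3)[OF that]])
    qed
    finally have "cs (inverse (2 * of_real pi * \<i>)) o\<^sub>L (cs (2 * of_real pi * \<i>) o\<^sub>L (- A)) = 0" by simp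
    moreover have "inverse (2 * of_real pi * \<i>) * (2 * of_real pi * \<i>) = 1" by (rule left_inverse) simp
    ultimately show "A = 0" by (simp only: cs_cancel neg_equal_0_iff_equal)
  qed
qed

lemma calc_unique:
  assumes "open U" "spec \<subseteq> U" "calc U f A" "calc U f B"
  shows "A = B"
proof -
  have "calc U (\<lambda>z. f z + (- 1) * f z) (A + (cs (- 1) o\<^sub>L B))"
    by (rule calc_add[OF assms(3) calc_scale[OF assms(4)]])
  then have "A + (cs (- 1) o\<^sub>L B) = 0" by (intro calc_zero_unique[OF assms(1,2)]) simp
  then show ?thesis by (simp add: cs_minus compose_simps)
qed

text \<open>The commutator AB - BA is a value of the zero function, with quotient hB - Bh, and hence
  vanishes by uniqueness.\<close>

lemma calc_commute:
  assumes "open U" "spec \<subseteq> U" "calc U f A" "J o\<^sub>L B = B o\<^sub>L J" "T o\<^sub>L B = B o\<^sub>L T"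
  shows "A o\<^sub>L B = B o\<^sub>L A"
proof -
  obtain h where h: "cauchy_on U h" "\<And>z. z \<in> U \<Longrightarrow> cs (f z) - A = (cs z - T) o\<^sub>L h z"
    using assms unfolding calc_def by auto
  have "cs 0 - ((A o\<^sub>L B) - (B o\<^sub>L A)) = (cs z - T) o\<^sub>L ((h z o\<^sub>L B) + (- B o\<^sub>L h z))" if "z \<in> U" for z
  proof -
    have "(cs z - T) o\<^sub>L B = B o\<^sub>L (cs z - T)"
      using cs_commute[OF assms(4), of z] assms(5) by (simp add: compose_simps)
    then have "(cs z - T) o\<^sub>L (B o\<^sub>L h z) = B o\<^sub>L ((cs z - T) o\<^sub>L h z)"
      by (metis blinfun_compose_assoc)
    moreover have "(cs z - T) o\<^sub>L (h z o\<^sub>L B) = ((cs z - T) o\<^sub>L h z) o\<^sub>L B"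
      by (simp only: blinfun_compose_assoc)
    ultimately have "(cs z - T) o\<^sub>L ((h z o\<^sub>L B) + (- B o\<^sub>L h z)) = ((cs (f z) - A) o\<^sub>L B) - (B o\<^sub>L (cs (f z) - A))"
      by (simp only: compose_simps(3,6,7) h(2)[OF that]) simp
    also have "\<dots> = (B o\<^sub>L A) - (A o\<^sub>L B)"
      using cs_commute[OF assms(4), of "f z"] by (simp add: compose_simps)
    finally show ?thesis by simp
  qed
  moreover have "cauchy_on U (\<lambda>z. (h z o\<^sub>L B) + (- B o\<^sub>L h z))"
    using assms(4) by (intro cauchy_on_add cauchy_on_compose_right cauchy_on_compose_left h(1)) (simp add: compose_simps)
  ultimately have "calc U (\<lambda>z. 0) ((A o\<^sub>L B) - (B o\<^sub>L A))"
    unfolding calc_def by (intro exI[of _ "\<lambda>z. (h z o\<^sub>L B) + (- B o\<^sub>L h z)"]) auto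
  from calc_zero_unique[OF assms(1,2) this] show ?thesis by simp
qed

text \<open>Take the division identity at \<open>cnj z\<close> and put \<open>S\<close> on both
  sides. Combined with uniqueness this detects real operators.\<close>

lemma calc_conjugate:
  assumes U: "open U" "\<And>z. z \<in> U \<Longrightarrow> cnj z \<in> U" and A: "calc U f A"
    and S: "S o\<^sub>L J = - (J o\<^sub>L S)" "S o\<^sub>L S = id_blinfun" "S o\<^sub>L T = T o\<^sub>L S"
  shows "calc U (\<lambda>z. cnj (f (cnj z))) (S o\<^sub>L A o\<^sub>L S)"
proof -
  obtain h where h: "cauchy_on U h" "\<And>z. z \<in> U \<Longrightarrow> cs (f z) - A = (cs z - T) o\<^sub>L h z"
    using A unfolding calc_def by auto
  have Scs: "S o\<^sub>L cs w = cs (cnj w) o\<^sub>L S" for w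
    using S(1) by (simp add: cs_def compose_simps)
  have "cs (cnj (f (cnj z))) - (S o\<^sub>L A o\<^sub>L S) = (cs z - T) o\<^sub>L (S o\<^sub>L h (cnj z) o\<^sub>L S)" if "z \<in> U" for z
  proof -
    have "cs (cnj w) = S o\<^sub>L cs w o\<^sub>L S" for w
      unfolding Scs blinfun_compose_assoc S(2) by simp
    then have "cs (cnj (f (cnj z))) - (S o\<^sub>L A o\<^sub>L S) = S o\<^sub>L (cs (f (cnj z)) - A) o\<^sub>L S"
      by (simp add: compose_simps)
    also have "\<dots> = S o\<^sub>L (cs (cnj z) - T) o\<^sub>L h (cnj z) o\<^sub>L S"
      using h(2)[OF U(2)[OF that]] by (simp add: blinfun_compose_assoc)
    also have "S o\<^sub>L (cs (cnj z) - T) = (cs z - T) o\<^sub>L S"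
      using S(3) by (simp add: Scs compose_simps)
    finally show ?thesis by (simp add: blinfun_compose_assoc)
  qed
  then show ?thesis unfolding calc_def using cauchy_on_conjugate[OF h(1) U S(1)] by blast
qed

text \<open>\<open>A\<close> is the Riesz-Dunford integral of \<open>f\<close>, and the quotient \<open>h\<close> is the Riesz-Dunford integral
  of the difference quotient of \<open>f\<close> at \<open>z\<close>.\<close>

lemma calc_exists:
  assumes U: "open U" "spec \<subseteq> U" and f: "f holomorphic_on U"
  shows "\<exists>A. calc U f A"
proof -
  define c where "c = inverse (2 * of_real pi * \<i>)"
  have c: "c * (2 * of_real pi * \<i>) = 1" unfolding c_def by (rule left_inverse) simp
  define q where "q z w = (if w = z then deriv f z else (f w - f z) / (w - z))" for z w
  have q_cont: "continuous_on (U \<times> U) (\<lambda>(z, w). q z w)"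
    unfolding q_def by (rule continuous_on_difference_quotient[OF f U(1)])
  have q_hol: "(\<lambda>w. q z w) holomorphic_on U" for z
    unfolding q_def by (rule pole_lemma_open[OF f U(1)])
  \<comment> \<open>Holomorphy in \<open>w\<close> comes from the removable singularity; symmetry
    carries it over to \<open>z\<close>.\<close>
  have q_sym: "q z w = q w z" for z w
    by (auto simp: q_def divide_simps) (simp add: algebra_simps)
  then have q_hol': "(\<lambda>z. q z w) holomorphic_on U" for w using q_hol[of w] by simp
  have q_mult: "(z - w) * q z w = f z - f w" for z w
    by (auto simp: q_def field_simps)
  from U show ?thesis
  proof (rule cutoff_resolvent)
    fix S :: "(nat \<times> nat) set" and lo hi \<phi> R
    assume S: "finite S" "\<And>q. q \<in> S \<Longrightarrow> rect (lo q) (hi q)" "\<And>q. q \<in> S \<Longrightarrow> cbox (lo q) (hi q) \<subseteq> U"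
      and R: "continuous_on UNIV R" and \<phi>: "continuous_on UNIV \<phi>"
      and TR: "\<And>z. (cs z - T) o\<^sub>L R z = \<phi> z *\<^sub>R id_blinfun"
      and sumR: "(\<Sum>q\<in>S. rint (lo q) (hi q) R) = cs (2 * of_real pi * \<i>)"
      and sum0: "\<And>k. continuous_on U k \<Longrightarrow> (\<And>q. q \<in> S \<Longrightarrow> rint (lo q) (hi q) k = 0) \<Longrightarrow>
       (\<Sum>q\<in>S. rint (lo q) (hi q) (\<lambda>z. \<phi> z *\<^sub>R k z)) = 0"
    have R': "continuous_on X R" and \<phi>': "continuous_on X \<phi>" for X
      using R \<phi> continuous_on_subset by blast+
    have cf: "continuous_on U f" using f by (rule holomorphic_on_imp_continuous_on)
    have SU: "rect_edges (lo s) (hi s) \<subseteq> U" if "s \<in> S" for s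
      using S(2,3)[OF that] rect_edges_subset by blast
    define k where "k z w = cs (q z w) o\<^sub>L R w" for z w
    have k_cont: "continuous_on (U \<times> U) (\<lambda>(z, w). k z w)"
      unfolding k_def split_def
      by (intro continuous_intros continuous_on_compose2[OF R] q_cont[unfolded split_def]) auto
    define h where "h z = cs c o\<^sub>L (\<Sum>s\<in>S. rint (lo s) (hi s) (k z))" for z
    define A where "A = cs c o\<^sub>L (\<Sum>s\<in>S. rint (lo s) (hi s) (\<lambda>w. cs (f w) o\<^sub>L R w))"
    have "cauchy_on U h"
    proof -
      have "cauchy_on U (\<lambda>z. rint (lo s) (hi s) (k z))" if s: "s \<in> S" for s
      proof (rule cauchy_onI)
        show "continuous_on U (\<lambda>z. rint (lo s) (hi s) (k z))"
          by (rule continuous_on_rint_param[OF continuous_on_subset[OF k_cont] S(2)[OF s]]) (use S(3)[OF s] in auto)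
        fix g a b assume g: "g holomorphic_on U" "rect a b" "cbox a b \<subseteq> U" "continuous_on (rect_edges a b) g"
        have cg: "continuous_on U g" using g(1) by (rule holomorphic_on_imp_continuous_on)
        have kz: "continuous_on (rect_edges (lo s) (hi s)) (k z)" if "z \<in> U" for z
        proof -
          have "continuous_on (rect_edges (lo s) (hi s)) (\<lambda>w. case (z, w) of (z, w) \<Rightarrow> k z w)"
            by (rule continuous_on_compose2[OF k_cont continuous_on_Pair[OF continuous_on_const continuous_on_id]])
               (use SU[OF s] that in blast)
          then show ?thesis by simp
        qed
        \<comment> \<open>For fixed \<open>w\<close> the integrand is a holomorphic scalar function
          of \<open>z\<close> times the constant \<open>R w\<close>. Fubini reduces Cauchy's theorem
          for \<open>h\<close> to this.\<close>
        have inner: "rint a b (\<lambda>z. cs (g z) o\<^sub>L k z w) = 0" for w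
          using rint_holomorphic[OF g(2) holomorphic_on_mult[OF g(1) q_hol'[of w]] g(3), of "R w"]
          by (simp add: k_def cs_mult blinfun_compose_assoc)
        have "rint a b (\<lambda>z. cs (g z) o\<^sub>L rint (lo s) (hi s) (k z))
            = rint a b (\<lambda>z. rint (lo s) (hi s) (\<lambda>w. cs (g z) o\<^sub>L k z w))"
          using g rect_edges_subset[OF g(2)]
          by (intro rint_cong) (auto intro!: rint_compose_left[symmetric] kz S(2) s J_cs_commute)
        also have "\<dots> = rint (lo s) (hi s) (\<lambda>w. rint a b (\<lambda>z. cs (g z) o\<^sub>L k z w))"
        proof (rule rint_rint_swap[OF _ g(2) S(2)[OF s]])
          have "continuous_on (U \<times> U) (\<lambda>(z, w). cs (g z) o\<^sub>L k z w)"
            using k_cont unfolding split_def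
            by (intro continuous_intros continuous_on_compose2[OF cg]) auto
          then show "continuous_on (cbox a b \<times> cbox (lo s) (hi s)) (\<lambda>(z, w). cs (g z) o\<^sub>L k z w)"
            by (rule continuous_on_subset) (use g(3) S(3)[OF s] in auto)
        qed
        finally show "rint a b (\<lambda>z. cs (g z) o\<^sub>L rint (lo s) (hi s) (k z)) = 0" by (simp add: inner)
      qed
      then show ?thesis
        unfolding h_def by (intro cauchy_on_compose_left J_cs_commute cauchy_on_sum S(1))
    qed
    moreover have "cs (f z) - A = (cs z - T) o\<^sub>L h z" if z: "z \<in> U" for z
    proof -
      \<comment> \<open>Composing \<open>cs (q z w)\<close> with
        \<open>(cs w - T) o\<^sub>L R w\<close> leaves \<open>\<phi> w *\<^sub>R p w\<close>. As
        \<open>q z\<close> is holomorphic, the integrals of this term over the cells add up to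
        zero.\<close>
      define p where "p w = cs (q z w) o\<^sub>L id_blinfun" for w
      have cq: "continuous_on U (q z)" using q_hol by (rule holomorphic_on_imp_continuous_on)
      have p_sum: "(\<Sum>s\<in>S. rint (lo s) (hi s) (\<lambda>w. \<phi> w *\<^sub>R p w)) = 0"
      proof (rule sum0)
        have p: "cauchy_on U p" unfolding p_def by (rule cauchy_on_holomorphic[OF q_hol])
        then show "continuous_on U p" by (simp add: cauchy_on_def)
        show "rint (lo s) (hi s) p = 0" if "s \<in> S" for s
          by (rule cauchy_on_rint_0[OF p S(2,3)[OF that]])
      qed
      \<comment> \<open>Split z - T = (z - w) + (w - T): the first part turns the difference
        quotient into f(z) - f(w), the second meets \<open>R w\<close> and leaves the
        cutoff.\<close>
      have eq: "(cs z - T) o\<^sub>L k z w = (cs (f z) o\<^sub>L R w) - (cs (f w) o\<^sub>L R w) + \<phi> w *\<^sub>R p w" for w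
      proof -
        have "(cs z - T) o\<^sub>L k z w = cs (q z w) o\<^sub>L ((cs z - T) o\<^sub>L R w)"
          by (simp add: k_def compose_simps cs_left_commute T_cs_left)
        also have "\<dots> = cs (q z w) o\<^sub>L (cs (z - w) + (cs w - T) o\<^sub>L R w)" by (simp add: cs_diff)
        also have "cs (q z w) o\<^sub>L (cs (z - w) + (cs w - T) o\<^sub>L R w)
          = (cs ((z - w) * q z w) o\<^sub>L R w) + (cs (q z w) o\<^sub>L ((cs w - T) o\<^sub>L R w))"
          by (simp only: compose_simps(2,3) mult.commute[of "z - w"] cs_mult blinfun_compose_assoc)
        also have "\<dots> = (cs (f z) o\<^sub>L R w) - (cs (f w) o\<^sub>L R w) + \<phi> w *\<^sub>R p w"
          unfolding q_mult TR p_def by (simp add: compose_simps cs_diff)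
        finally show ?thesis .
      qed
      have Jz: "J o\<^sub>L (cs z - T) = (cs z - T) o\<^sub>L J" by (simp add: compose_simps J_T J_cs_commute)
      have "(cs z - T) o\<^sub>L rint (lo s) (hi s) (k z) = (cs (f z) o\<^sub>L rint (lo s) (hi s) R)
          - rint (lo s) (hi s) (\<lambda>w. cs (f w) o\<^sub>L R w) + rint (lo s) (hi s) (\<lambda>w. \<phi> w *\<^sub>R p w)" if s: "s \<in> S" for s
      proof -
        have cts: "continuous_on (rect_edges (lo s) (hi s)) f" "continuous_on (rect_edges (lo s) (hi s)) (q z)"
          using cf cq SU[OF s] continuous_on_subset by blast+
        have "(cs z - T) o\<^sub>L rint (lo s) (hi s) (k z) = rint (lo s) (hi s) (\<lambda>w. (cs z - T) o\<^sub>L k z w)"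
          unfolding k_def by (intro rint_compose_left[symmetric] S(2) s Jz continuous_intros cts R')
        also have "\<dots> = rint (lo s) (hi s) (\<lambda>w. (cs (f z) o\<^sub>L R w) - (cs (f w) o\<^sub>L R w)) + rint (lo s) (hi s) (\<lambda>w. \<phi> w *\<^sub>R p w)"
          unfolding eq p_def by (intro rint_add S(2) s continuous_intros cts R' \<phi>')
        also have "rint (lo s) (hi s) (\<lambda>w. (cs (f z) o\<^sub>L R w) - (cs (f w) o\<^sub>L R w))
            = rint (lo s) (hi s) (\<lambda>w. cs (f z) o\<^sub>L R w) - rint (lo s) (hi s) (\<lambda>w. cs (f w) o\<^sub>L R w)"
          by (intro rint_diff S(2) s continuous_intros cts R')
        also have "rint (lo s) (hi s) (\<lambda>w. cs (f z) o\<^sub>L R w) = cs (f z) o\<^sub>L rint (lo s) (hi s) R"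
          by (intro rint_compose_left S(2) s R' J_cs_commute)
        finally show ?thesis .
      qed
      then have "(cs z - T) o\<^sub>L (\<Sum>s\<in>S. rint (lo s) (hi s) (k z))
        = (cs (f z) o\<^sub>L cs (2 * of_real pi * \<i>)) - (\<Sum>s\<in>S. rint (lo s) (hi s) (\<lambda>w. cs (f w) o\<^sub>L R w))"
        unfolding sumR[symmetric]
        by (simp add: compose_sum_right sum.distrib sum_subtractf p_sum)
      then have "cs c o\<^sub>L ((cs z - T) o\<^sub>L (\<Sum>s\<in>S. rint (lo s) (hi s) (k z)))
        = (cs c o\<^sub>L (cs (2 * of_real pi * \<i>) o\<^sub>L cs (f z))) - A"
        by (simp only: A_def compose_simps(5) cs_cs_commute[of "f z"])
      then have "cs c o\<^sub>L ((cs z - T) o\<^sub>L (\<Sum>s\<in>S. rint (lo s) (hi s) (k z))) = cs (f z) - A"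
        by (simp only: cs_cancel[OF c])
      then show ?thesis
        by (simp add: h_def compose_simps cs_left_commute T_cs_left)
    qed
    ultimately show ?thesis unfolding calc_def by blast
  qed
qed

end

subsection \<open>Real operators\<close>

definition complexification :: "('v::real_normed_vector \<Rightarrow>\<^sub>L 'v) \<Rightarrow> ('v \<times> 'v) \<Rightarrow>\<^sub>L ('v \<times> 'v)" where
  "complexification A = Blinfun (\<lambda>p. (blinfun_apply A (fst p), blinfun_apply A (snd p)))"

text \<open>Multiplication by the imaginary unit on \<open>'v \<times> 'v\<close>.\<close>

definition rotation :: "('v::real_normed_vector \<times> 'v) \<Rightarrow>\<^sub>L ('v \<times> 'v)" where
  "rotation = Blinfun (\<lambda>p. (- snd p, fst p))"

definition conjugation :: "('v::real_normed_vector \<times> 'v) \<Rightarrow>\<^sub>L ('v \<times> 'v)" where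
  "conjugation = Blinfun (\<lambda>p. (fst p, - snd p))"

lemma complexification_apply [simp]: "complexification A p = (A (fst p), A (snd p))"
  unfolding complexification_def
  by (subst bounded_linear_Blinfun_apply)
     (auto intro!: bounded_linear_Pair bounded_linear_compose[OF blinfun.bounded_linear_right]
        bounded_linear_fst bounded_linear_snd)

lemma rotation_apply [simp]: "rotation p = (- snd p, fst p)"
  unfolding rotation_def
  by (subst bounded_linear_Blinfun_apply)
     (auto intro!: bounded_linear_Pair bounded_linear_minus bounded_linear_fst bounded_linear_snd)

lemma conjugation_apply [simp]: "conjugation p = (fst p, - snd p)"
  unfolding conjugation_def
  by (subst bounded_linear_Blinfun_apply)
     (auto intro!: bounded_linear_Pair bounded_linear_minus bounded_linear_fst bounded_linear_snd)

lemma complexification_add: "complexification (A + B) = complexification A + complexification B"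
  and complexification_scaleR: "complexification (r *\<^sub>R A) = r *\<^sub>R complexification A"
  and complexification_compose: "complexification (A o\<^sub>L B) = complexification A o\<^sub>L complexification B"
  and complexification_0: "complexification 0 = 0"
  and complexification_id: "complexification id_blinfun = id_blinfun"
  by (rule blinfun_eqI, simp add: blinfun.add_left blinfun.scaleR_left prod_eq_iff)+

lemma complexification_power: "complexification (blinfun_power A k) = blinfun_power (complexification A) k"
  by (induction k) (simp_all add: complexification_id complexification_compose)

lemma complexification_inject: "complexification A = complexification B \<Longrightarrow> A = B"
proof (rule blinfun_eqI)
  fix x assume "complexification A = complexification B"
  then have "complexification A (x, 0) = complexification B (x, 0)" by simp
  then show "A x = B x" by simp
qed

lemma rotation_complexification: "rotation o\<^sub>L complexification A = complexification A o\<^sub>L rotation"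
  by (rule blinfun_eqI) (simp add: blinfun.minus_right)

lemma conjugation_complexification: "conjugation o\<^sub>L complexification A = complexification A o\<^sub>L conjugation"
  by (rule blinfun_eqI) (simp add: blinfun.minus_right)

lemma conjugation_rotation: "conjugation o\<^sub>L rotation = - (rotation o\<^sub>L conjugation)"
  by (rule blinfun_eqI) (simp add: blinfun.minus_left)

lemma conjugation_conjugation: "conjugation o\<^sub>L conjugation = id_blinfun"
  by (rule blinfun_eqI) simp

text \<open>Invariance under conjugation makes the imaginary part of \<open>A (v, 0)\<close> equal
  to its own negative, so \<open>A\<close> preserves the real subspace; commuting with
  \<open>rotation\<close> then determines \<open>A\<close> on the imaginary part.\<close>

lemma real_operator:
  fixes A :: "('v::real_normed_vector \<times> 'v) \<Rightarrow>\<^sub>L ('v \<times> 'v)"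
  assumes J: "A o\<^sub>L rotation = rotation o\<^sub>L A" and S: "conjugation o\<^sub>L A o\<^sub>L conjugation = A"
  shows "\<exists>a. A = complexification a"
proof -
  define a where "a = Blinfun (\<lambda>v. fst (A (v, 0)))"
  have "bounded_linear (\<lambda>v. fst (A (v, 0)))"
    by (intro bounded_linear_compose[OF bounded_linear_fst] bounded_linear_compose[OF blinfun.bounded_linear_right]
        bounded_linear_Pair bounded_linear_ident bounded_linear_zero)
  then have a: "a v = fst (A (v, 0))" for v unfolding a_def by (subst bounded_linear_Blinfun_apply) auto
  have 1: "A (v, 0) = (a v, 0)" for v
  proof -
    have "(conjugation o\<^sub>L A o\<^sub>L conjugation) (v, 0) = A (v, 0)" by (simp only: S)
    then have "- snd (A (v, 0)) = snd (A (v, 0))" by (simp add: prod_eq_iff)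
    then have "2 *\<^sub>R snd (A (v, 0)) = 0" by (metis add.left_inverse scaleR_2)
    then show ?thesis by (simp add: a prod_eq_iff)
  qed
  have 2: "A (0, v) = (0, a v)" for v
  proof -
    have "(A o\<^sub>L rotation) (v, 0) = (rotation o\<^sub>L A) (v, 0)" by (simp only: J)
    then show ?thesis by (simp add: 1)
  qed
  have "A p = complexification a p" for p
  proof -
    have "A p = A (fst p, 0) + A (0, snd p)" by (simp add: blinfun.add_right[symmetric])
    then show ?thesis by (simp add: 1 2)
  qed
  then show ?thesis by (intro exI[of _ a] blinfun_eqI)
qed

lemma complex_structure_rotation: "complex_structure (rotation :: ('v::banach \<times> 'v) \<Rightarrow>\<^sub>L ('v \<times> 'v))"
  by unfold_locales (rule blinfun_eqI, simp add: blinfun.minus_left prod_eq_iff)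

lemma complex_operator_complexification: "complex_operator rotation (complexification (T :: 'v::banach \<Rightarrow>\<^sub>L 'v))"
  by (intro complex_operator.intro complex_structure_rotation complex_operator_axioms.intro
      rotation_complexification)

section \<open>The calculus with values in operators on the real space\<close>

definition real_calc :: "('v::banach \<Rightarrow>\<^sub>L 'v) \<Rightarrow> complex set \<Rightarrow> (complex \<Rightarrow> complex) \<Rightarrow> ('v \<Rightarrow>\<^sub>L 'v) \<Rightarrow> bool" where
  "real_calc T U f A \<longleftrightarrow> complex_operator.calc rotation (complexification T) U f (complexification A)"

context
  fixes T :: "'v::banach \<Rightarrow>\<^sub>L 'v"
begin

interpretation complex_operator rotation "complexification T"
  by (rule complex_operator_complexification)

text \<open>A complex linear bounded inverse is in particular a real linear one; thus the hypothesis
  on the complex spectrum passes to \<open>spec\<close>.\<close>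

lemma spec_subset_complex_spectrum: "spec \<subseteq> complex_spectrum T"
proof
  fix z assume z: "z \<in> spec"
  have cs: "cs z p = cscale z p" for p
    by (simp add: cs_def cscale_def blinfun.add_left blinfun.scaleR_left prod_eq_iff)
  show "z \<in> complex_spectrum T"
  proof (rule ccontr)
    assume "z \<notin> complex_spectrum T"
    then obtain S where S: "S \<in> bounded_clinear_ops" "S \<circ> (\<lambda>p. cscale z p - complexify T p) = id"
      "(\<lambda>p. cscale z p - complexify T p) \<circ> S = id"
      unfolding complex_spectrum_def by auto
    have app: "Blinfun S p = S p" for p
      using S(1) by (simp add: bounded_clinear_ops_def bounded_linear_Blinfun_apply)
    have d: "(cs z - complexification T) p = cscale z p - complexify T p" for p
      by (simp add: blinfun.diff_left cs complexify_def)
    have "blinfun_inverts (cs z - complexification T) (Blinfun S)"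
      unfolding blinfun_inverts_def
      using fun_cong[OF S(2)] fun_cong[OF S(3)] by (auto intro!: blinfun_eqI simp: app d)
    then show False using z unfolding spec_def by blast
  qed
qed

lemma real_calc_unique:
  "open U \<Longrightarrow> complex_spectrum T \<subseteq> U \<Longrightarrow> real_calc T U f A \<Longrightarrow> real_calc T U f B \<Longrightarrow> A = B"
  unfolding real_calc_def
  by (rule complexification_inject, rule calc_unique[OF _ order_trans[OF spec_subset_complex_spectrum]])

text \<open>Uniqueness converts symmetry into reality: as \<open>f\<close> commutes with
  conjugation, the conjugated operator is again a value of \<open>f\<close> and so equals
  \<open>A\<close>. Commutation with \<open>rotation\<close> is \<open>calc_commute\<close> applied
  to \<open>rotation\<close> itself.\<close>

lemma real_calc_exists:
  assumes U: "open U" "conjugate_symmetric U" "complex_spectrum T \<subseteq> U"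
    and f: "f holomorphic_on U" "\<And>z. z \<in> U \<Longrightarrow> f (cnj z) = cnj (f z)"
  shows "\<exists>A. real_calc T U f A"
proof -
  have sp: "spec \<subseteq> U" using U(3) spec_subset_complex_spectrum by blast
  have cU: "cnj z \<in> U" if "z \<in> U" for z using U(2) that by (simp add: conjugate_symmetric_def)
  obtain A where A: "calc U f A" using calc_exists[OF U(1) sp f(1)] by blast
  have "calc U (\<lambda>z. cnj (f (cnj z))) (conjugation o\<^sub>L A o\<^sub>L conjugation)"
    by (rule calc_conjugate[OF U(1) cU A conjugation_rotation conjugation_conjugation conjugation_complexification])
  then have "calc U f (conjugation o\<^sub>L A o\<^sub>L conjugation)"
    by (rule calc_cong[THEN iffD1, rotated]) (simp add: f)
  then have "conjugation o\<^sub>L A o\<^sub>L conjugation = A" using calc_unique[OF U(1) sp _ A] by blast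
  moreover have "A o\<^sub>L rotation = rotation o\<^sub>L A"
    by (rule calc_commute[OF U(1) sp A refl rotation_complexification[symmetric]])
  ultimately obtain a where "A = complexification a" using real_operator by blast
  then show ?thesis using A unfolding real_calc_def by blast
qed

lemma real_calc_cong: "(\<And>z. z \<in> U \<Longrightarrow> f z = g z) \<Longrightarrow> real_calc T U f A \<longleftrightarrow> real_calc T U g A"
  unfolding real_calc_def by (rule calc_cong)

lemma real_calc_add: "real_calc T U f A \<Longrightarrow> real_calc T U g B \<Longrightarrow> real_calc T U (\<lambda>z. f z + g z) (A + B)"
  unfolding real_calc_def complexification_add by (rule calc_add)

lemma real_calc_mult:
  "real_calc T U f A \<Longrightarrow> real_calc T U g B \<Longrightarrow> f holomorphic_on U \<Longrightarrow> real_calc T U (\<lambda>z. f z * g z) (A o\<^sub>L B)"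
  unfolding real_calc_def complexification_compose by (rule calc_mult)

lemma real_calc_scaleR: "real_calc T U f A \<Longrightarrow> real_calc T U (\<lambda>z. of_real r * f z) (r *\<^sub>R A)"
  unfolding real_calc_def complexification_scaleR
  using calc_scale[of U f "complexification A" "of_real r"] by (simp add: cs_of_real compose_simps)

lemma real_calc_zero: "real_calc T U (\<lambda>z. 0) 0"
  unfolding real_calc_def complexification_0 using calc_const[of U 0] by simp

lemma real_calc_power: "real_calc T U (\<lambda>z. z ^ k) (blinfun_power T k)"
  unfolding real_calc_def complexification_power by (rule calc_power)

text \<open>Intended for \<open>B\<close> a right multiplication by a Clifford element.\<close>

lemma real_calc_commute:
  assumes "open U" "complex_spectrum T \<subseteq> U" "real_calc T U f A" "T o\<^sub>L B = B o\<^sub>L T"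
  shows "A o\<^sub>L B = B o\<^sub>L A"
proof (rule complexification_inject)
  have sp: "spec \<subseteq> U" using assms(2) spec_subset_complex_spectrum by blast
  show "complexification (A o\<^sub>L B) = complexification (B o\<^sub>L A)"
    unfolding complexification_compose
  proof (rule calc_commute[OF assms(1) sp _ rotation_complexification])
    show "calc U f (complexification A)" using assms(3) by (simp add: real_calc_def)
    show "complexification T o\<^sub>L complexification B = complexification B o\<^sub>L complexification T"
      using assms(4) by (metis complexification_compose)
  qed
qed

end

lemma real_calc_sum:
  "finite K \<Longrightarrow> (\<And>k. k \<in> K \<Longrightarrow> real_calc T U (f k) (A k)) \<Longrightarrow> real_calc T U (\<lambda>z. \<Sum>k\<in>K. f k z) (\<Sum>k\<in>K. A k)"
  by (induction K rule: finite_induct) (simp_all add: real_calc_zero real_calc_add)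

subsection \<open>Clifford coefficients\<close>

lemma cl_scalar_in_clifford: "cl_scalar c \<in> clifford n"
  by (auto simp: cl_scalar_def clifford_def)

lemma cl_basis_in_clifford: "J \<subseteq> {1..n} \<Longrightarrow> cl_basis J \<in> clifford n"
  by (auto simp: cl_basis_def clifford_def)

context banach_cl_space
begin

text \<open>Real homogeneity follows from associativity of the action: \<open>cl_scalar r\<close>
  acts as the real number \<open>r\<close> and commutes with \<open>a\<close> in the Clifford
  algebra.\<close>

lemma bounded_linear_lact:
  assumes "a \<in> clifford n"
  shows "bounded_linear (lact a)"
proof -
  obtain C where C: "\<forall>x. \<forall>a\<in>clifford n. norm (ract x a) \<le> C * norm x * cl_norm n a \<and> norm (lact a x) \<le> C * norm x * cl_norm n a"
    using act_bounded by blast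
  have "lact a (r *\<^sub>R x) = r *\<^sub>R lact a x" for r x
    using lact_mult[OF assms cl_scalar_in_clifford, of r x] lact_mult[OF cl_scalar_in_clifford assms, of r x] assms
    by (simp add: lact_scalar cl_scalar_mult_left cl_scalar_mult_right)
  then show ?thesis
    using C assms by (intro bounded_linear_intro[of _ "C * cl_norm n a"]) (auto simp: lact_add_right ac_simps)
qed

lemma bounded_linear_ract:
  assumes "a \<in> clifford n"
  shows "bounded_linear (\<lambda>x. ract x a)"
proof -
  obtain C where C: "\<forall>x. \<forall>a\<in>clifford n. norm (ract x a) \<le> C * norm x * cl_norm n a \<and> norm (lact a x) \<le> C * norm x * cl_norm n a"
    using act_bounded by blast
  have "ract (r *\<^sub>R x) a = r *\<^sub>R ract x a" for r x
    using ract_mult[OF assms cl_scalar_in_clifford, of x r] ract_mult[OF cl_scalar_in_clifford assms, of x r] assms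
    by (simp add: ract_scalar cl_scalar_mult_left cl_scalar_mult_right)
  then show ?thesis
    using C assms by (intro bounded_linear_intro[of _ "C * cl_norm n a"]) (auto simp: ract_add_left ac_simps)
qed

lemma lact_sum_basis:
  assumes "finite K" "K \<subseteq> Pow {1..n}"
  shows "lact (\<lambda>L. \<Sum>J\<in>K. r J * cl_basis J L) x = (\<Sum>J\<in>K. r J *\<^sub>R lact (cl_basis J) x)"
  using assms
proof (induction K rule: finite_induct)
  case empty
  have "(\<lambda>L. 0) = cl_scalar (0::real)" by (auto simp: cl_scalar_def)
  then show ?case using lact_scalar[of 0 x] by simp
next
  case (insert J K)
  have b: "cl_basis J \<in> clifford n" using insert by (intro cl_basis_in_clifford) auto
  have e: "cl_mult n (cl_scalar (r J)) (cl_basis J) = (\<lambda>L. r J * cl_basis J L)"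
    using cl_scalar_mult_left[OF b] .
  have "lact (\<lambda>L. r J * cl_basis J L) x = r J *\<^sub>R lact (cl_basis J) x"
    using lact_mult[OF cl_scalar_in_clifford b, of "r J" x] by (simp add: e lact_scalar)
  moreover have "(\<lambda>L. r J * cl_basis J L) \<in> clifford n" using cl_mult_closed[of n "cl_scalar (r J)" "cl_basis J"] e by simp
  moreover have "(\<lambda>L. \<Sum>J\<in>K. r J * cl_basis J L) \<in> clifford n"
    unfolding clifford_def using insert by (auto simp: cl_basis_def intro!: sum.neutral)
  ultimately show ?case using insert by (simp add: lact_add_left)
qed

lemma lact_expand:
  assumes "a \<in> clifford n"
  shows "lact a x = (\<Sum>J\<in>Pow {1..n}. a J *\<^sub>R lact (cl_basis J) x)"
proof -
  have "(\<lambda>L. \<Sum>J\<in>Pow {1..n}. a J * cl_basis J L) = a"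
  proof
    fix L show "(\<Sum>J\<in>Pow {1..n}. a J * cl_basis J L) = a L"
      using assms by (cases "L \<subseteq> {1..n}") (auto simp: cl_basis_def clifford_def if_distrib[of "(*) _"] cong: if_cong)
  qed
  then show ?thesis using lact_sum_basis[of "Pow {1..n}" a x] by simp
qed

end

section \<open>The calculus for Clifford-valued functions\<close>

theorem corollary3:
  fixes n :: nat
    and lact :: "(nat set \<Rightarrow> real) \<Rightarrow> 'v::banach \<Rightarrow> 'v"
    and ract :: "'v \<Rightarrow> (nat set \<Rightarrow> real) \<Rightarrow> 'v"
    and U :: "complex set"
    and T :: "'v \<Rightarrow>\<^sub>L 'v"
  assumes "banach_cl_space n lact ract"
    and "open U" and "conjugate_symmetric U"
    and "T \<in> right_linear_ops n ract"
    and "complex_spectrum T \<subseteq> U"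
  shows "\<exists>\<Phi> :: (complex \<Rightarrow> nat set \<Rightarrow> complex) \<Rightarrow> ('v \<Rightarrow>\<^sub>L 'v).
    (\<forall>F\<in>stem_functions n U. \<Phi> F \<in> right_linear_ops n ract)
    \<and> (\<forall>F\<in>stem_functions n U. \<forall>G\<in>stem_functions n U.
        (\<forall>z\<in>U. F z = G z) \<longrightarrow> \<Phi> F = \<Phi> G)
    \<and> (\<forall>F\<in>stem_functions n U. \<forall>G\<in>stem_functions n U.
        \<Phi> (\<lambda>z J. F z J + G z J) = \<Phi> F + \<Phi> G)
    \<and> (\<forall>r::real. \<forall>F\<in>stem_functions n U. \<Phi> (\<lambda>z J. of_real r * F z J) = r *\<^sub>R \<Phi> F)
    \<and> (\<forall>F\<in>stem_functions n U. \<forall>f\<in>scalar_stem_functions n U.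
        \<Phi> (\<lambda>z. cl_mult n (F z) (f z)) = \<Phi> F o\<^sub>L \<Phi> f)
    \<and> (\<forall>m. \<forall>a. (\<forall>k\<le>m. a k \<in> clifford n) \<longrightarrow>
        (\<forall>x. blinfun_apply (\<Phi> (cl_poly a m)) x
          = (\<Sum>k\<le>m. lact (a k) ((blinfun_apply T ^^ k) x))))"
proof -
  interpret banach_cl_space n lact ract by (rule assms(1))
  note unique = real_calc_unique[OF assms(2,5)]
  \<comment> \<open>Meaningful only where a real value exists; \<open>calc\<close> provides it for
    the components of stem functions.\<close>
  define \<phi> where "\<phi> f = (THE A. real_calc T U f A)" for f
  have \<phi>_eq: "\<phi> f = A" if "real_calc T U f A" for f A
    unfolding \<phi>_def using that unique by blast
  have hol: "(\<lambda>z. F z J) holomorphic_on U" if "F \<in> stem_functions n U" "J \<subseteq> {1..n}" for F J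
    using that assms(2) by (auto simp: stem_functions_def analytic_on_open)
  have calc: "real_calc T U (\<lambda>z. F z J) (\<phi> (\<lambda>z. F z J))" if F: "F \<in> stem_functions n U" and J: "J \<subseteq> {1..n}" for F J
  proof -
    have "\<exists>A. real_calc T U (\<lambda>z. F z J) A"
      using F by (intro real_calc_exists[OF assms(2,3,5)] hol[OF F J])
        (auto simp: stem_functions_def cl_cnj_def)
    then show ?thesis using \<phi>_eq by blast
  qed
  \<comment> \<open>These operators need not commute with \<open>T\<close>, so they are kept to the
    left in every composition.\<close>
  define E where "E J = Blinfun (lact (cl_basis J))" for J
  have E: "E J x = lact (cl_basis J) x" if "J \<subseteq> {1..n}" for J x
    unfolding E_def using bounded_linear_lact[OF cl_basis_in_clifford[OF that]] by (simp add: bounded_linear_Blinfun_apply)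
  define \<Phi> where "\<Phi> F = (\<Sum>J\<in>Pow {1..n}. E J o\<^sub>L \<phi> (\<lambda>z. F z J))" for F
  \<comment> \<open>Works from component values alone, so that sums, products and polynomials can be
    evaluated directly from the scalar calculus.\<close>
  have \<Phi>_eq: "\<Phi> F = (\<Sum>J\<in>Pow {1..n}. E J o\<^sub>L A J)"
    if "\<And>J. J \<subseteq> {1..n} \<Longrightarrow> real_calc T U (\<lambda>z. F z J) (A J)" for F A
    unfolding \<Phi>_def using that by (intro sum.cong refl arg_cong2[where f = "(o\<^sub>L)"] \<phi>_eq) blast
  have \<Phi>_apply: "\<Phi> F x = (\<Sum>J\<in>Pow {1..n}. lact (cl_basis J) (\<phi> (\<lambda>z. F z J) x))" for F x
    unfolding \<Phi>_def blinfun.sum_left by (intro sum.cong) (auto simp: E)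
  have 1: "\<Phi> F \<in> right_linear_ops n ract" if F: "F \<in> stem_functions n U" for F
    unfolding right_linear_ops_def
  proof (intro CollectI allI ballI)
    fix x and a :: "nat set \<Rightarrow> real" assume a: "a \<in> clifford n"
    define B where "B = Blinfun (\<lambda>x. ract x a)"
    have B: "B x = ract x a" for x
      unfolding B_def using bounded_linear_ract[OF a] by (simp add: bounded_linear_Blinfun_apply)
    \<comment> \<open>Right linearity of \<open>T\<close>, read as commutation with
      \<open>B\<close>. The scalar calculus inherits it, and \<open>lact_ract\<close> moves
      \<open>B\<close> past the basis elements.\<close>
    have "T o\<^sub>L B = B o\<^sub>L T"
      using assms(4) a by (intro blinfun_eqI) (simp add: B right_linear_ops_def)
    then have "\<phi> (\<lambda>z. F z J) o\<^sub>L B = B o\<^sub>L \<phi> (\<lambda>z. F z J)" if "J \<subseteq> {1..n}" for J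
      using real_calc_commute[OF assms(2,5) calc[OF F that]] by blast
    then have c: "\<phi> (\<lambda>z. F z J) (ract x a) = ract (\<phi> (\<lambda>z. F z J) x) a" if "J \<subseteq> {1..n}" for J
      using that by (metis B blinfun_apply_blinfun_compose)
    have "ract (\<Phi> F x) a = (\<Sum>J\<in>Pow {1..n}. ract (lact (cl_basis J) (\<phi> (\<lambda>z. F z J) x)) a)"
      unfolding \<Phi>_apply by (rule linear_sum[OF bounded_linear.linear[OF bounded_linear_ract[OF a]]])
    also have "\<dots> = (\<Sum>J\<in>Pow {1..n}. lact (cl_basis J) (\<phi> (\<lambda>z. F z J) (ract x a)))"
      by (intro sum.cong refl) (simp add: c lact_ract cl_basis_in_clifford a)
    finally show "\<Phi> F (ract x a) = ract (\<Phi> F x) a" by (simp add: \<Phi>_apply)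
  qed
  have 2: "\<Phi> F = \<Phi> G" if F: "F \<in> stem_functions n U" and G: "G \<in> stem_functions n U" and "\<forall>z\<in>U. F z = G z" for F G
  proof -
    have "real_calc T U (\<lambda>z. F z J) (\<phi> (\<lambda>z. G z J))" if "J \<subseteq> {1..n}" for J
      using calc[OF G that] \<open>\<forall>z\<in>U. F z = G z\<close> by (subst real_calc_cong) auto
    from \<Phi>_eq[OF this] show ?thesis by (simp add: \<Phi>_def)
  qed
  have 3: "\<Phi> (\<lambda>z J. F z J + G z J) = \<Phi> F + \<Phi> G" if F: "F \<in> stem_functions n U" and G: "G \<in> stem_functions n U" for F G
    using \<Phi>_eq[of "\<lambda>z J. F z J + G z J", OF real_calc_add[OF calc[OF F] calc[OF G]]]
    by (simp add: \<Phi>_def compose_simps sum.distrib)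
  have 4: "\<Phi> (\<lambda>z J. of_real r * F z J) = r *\<^sub>R \<Phi> F" if F: "F \<in> stem_functions n U" for F r
    using \<Phi>_eq[of "\<lambda>z J. of_real r * F z J", OF real_calc_scaleR[OF calc[OF F]]]
    by (simp add: \<Phi>_def compose_simps scaleR_sum_right)
  have 5: "\<Phi> (\<lambda>z. cl_mult n (F z) (f z)) = \<Phi> F o\<^sub>L \<Phi> f"
    if F: "F \<in> stem_functions n U" and f: "f \<in> scalar_stem_functions n U" for F f
  proof -
    have fs: "f \<in> stem_functions n U" using f by (simp add: scalar_stem_functions_def)
    have fz: "f z = cl_scalar (f z {})" if "z \<in> U" for z
    proof -
      obtain c where "f z = cl_scalar c" using f \<open>z \<in> U\<close> unfolding scalar_stem_functions_def by blast
      then show ?thesis by (simp add: cl_scalar_def)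
    qed
    have E0: "E {} = id_blinfun"
    proof (rule blinfun_eqI)
      fix x
      have "cl_basis {} = cl_scalar (1::real)" by (auto simp: cl_basis_def cl_scalar_def)
      then show "E {} x = id_blinfun x" using lact_scalar[of 1 x] by (simp add: E)
    qed
    \<comment> \<open>A scalar function has only the component at the empty set, and
      \<open>E {}\<close> is the identity.\<close>
    have "\<Phi> f = (\<Sum>J\<in>Pow {1..n}. E J o\<^sub>L (if J = {} then \<phi> (\<lambda>z. f z {}) else 0))"
    proof (rule \<Phi>_eq)
      fix J assume J: "J \<subseteq> {1..n}"
      have "f z J = 0" if "z \<in> U" "J \<noteq> {}" for z
        using fz[OF that(1)] that(2) by (metis cl_scalar_def)
      then show "real_calc T U (\<lambda>z. f z J) (if J = {} then \<phi> (\<lambda>z. f z {}) else 0)"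
        using calc[OF fs J] real_calc_zero[of T U] real_calc_cong[of U "\<lambda>z. f z J" "\<lambda>z. 0" T 0] by auto
    qed
    also have "\<dots> = (\<Sum>J\<in>Pow {1..n}. if J = {} then \<phi> (\<lambda>z. f z {}) else 0)"
      by (intro sum.cong) (auto simp: E0)
    finally have \<Phi>f: "\<Phi> f = \<phi> (\<lambda>z. f z {})" by simp
    \<comment> \<open>A scalar factor acts coefficientwise, so each component is a product of two
      scalar functions, and \<open>\<phi> (\<lambda>z. f z {})\<close> can be factored out on the
      right.\<close>
    have "real_calc T U (\<lambda>z. cl_mult n (F z) (f z) J) (\<phi> (\<lambda>z. F z J) o\<^sub>L \<phi> (\<lambda>z. f z {}))" if J: "J \<subseteq> {1..n}" for J
    proof (rule real_calc_cong[THEN iffD1, OF _ real_calc_mult[OF calc[OF F J] calc[OF fs] hol[OF F J]]])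
      fix z assume z: "z \<in> U"
      then have "F z \<in> clifford n" using F by (simp add: stem_functions_def)
      then show "F z J * f z {} = cl_mult n (F z) (f z) J"
        by (subst fz[OF z], subst cl_scalar_mult_right) (auto simp: mult.commute)
    qed simp
    from \<Phi>_eq[OF this] show ?thesis
      unfolding \<Phi>f by (simp add: \<Phi>_def compose_sum_left blinfun_compose_assoc)
  qed
  have 6: "\<Phi> (cl_poly a m) x = (\<Sum>k\<le>m. lact (a k) ((blinfun_apply T ^^ k) x))"
    if a: "\<forall>k\<le>m. a k \<in> clifford n" for a m x
  proof -
    \<comment> \<open>Each component is a polynomial with real coefficients. Exchanging the sums
      over \<open>J\<close> and \<open>k\<close> afterwards reassembles the Clifford
      coefficients.\<close>
    have "real_calc T U (\<lambda>z. cl_poly a m z J) (\<Sum>k\<le>m. a k J *\<^sub>R blinfun_power T k)" for J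
      unfolding cl_poly_def by (intro real_calc_sum real_calc_scaleR real_calc_power) auto
    from \<Phi>_eq[OF this] have "\<Phi> (cl_poly a m) x
        = (\<Sum>J\<in>Pow {1..n}. E J (\<Sum>k\<le>m. a k J *\<^sub>R (blinfun_apply T ^^ k) x))"
      by (simp add: blinfun.sum_left blinfun.scaleR_left blinfun_power_apply)
    also have "\<dots> = (\<Sum>J\<in>Pow {1..n}. \<Sum>k\<le>m. a k J *\<^sub>R lact (cl_basis J) ((blinfun_apply T ^^ k) x))"
      by (intro sum.cong refl) (simp add: blinfun.sum_right blinfun.scaleR_right E)
    also have "\<dots> = (\<Sum>k\<le>m. \<Sum>J\<in>Pow {1..n}. a k J *\<^sub>R lact (cl_basis J) ((blinfun_apply T ^^ k) x))"
      by (rule sum.swap)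
    also have "\<dots> = (\<Sum>k\<le>m. lact (a k) ((blinfun_apply T ^^ k) x))"
      using a by (intro sum.cong refl) (simp add: lact_expand)
    finally show ?thesis .
  qed
  show ?thesis
    using 1 2 3 4 5 6 by (intro exI[of _ \<Phi>] conjI ballI allI impI)
qed

end
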